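(* Let $b\in\{1,0,-1\}$ and $k\in\mathbb R$, $k\neq0$, and assume that $K'(\beta_c)b-k<0$. For $\alpha>0$ define $$\beta_n=\beta_c+b/n^\alpha,\qquad K_n=K(\beta_c)+k/n^\alpha .$$ Let $$g(x)=\beta_c\bigl(K'(\beta_c)b-k\bigr)x^2+c_6x^6,\qquad \tilde g(x)=c_6x^6,\qquad c_6=9/40,$$ let $\bar x>0$ be the unique positive global minimum point of $g$, and let $$\bar y=\frac{\int_{\mathbb R}|x|\exp[-\tilde g(x)]\,dx}{\int_{\mathbb R}\exp[-\tilde g(x)]\,dx},\qquad \bar z=\frac{\int_{\mathbb R}|x|\exp[-g(x)]\,dx}{\int_{\mathbb R}\exp[-g(x)]\,dx}.$$ Then: (a) For all $\alpha>0$, $m(\beta_n,K_n)\sim\bar x/n^{\alpha/4}$. If $b\neq0$, then $m(\beta_n,K_n)\sim\bar x|\beta_c-\beta_n|^{1/4}$. (b) For all $0<\alpha<\alpha_0=2/3$, $E_{n,\beta_n,K_n}\{|S_n/n|\}\sim\bar x/n^{\alpha/4}\sim m(\beta_n,K_n)$. (c) For all $\alpha>\alpha_0=2/3$, $E_{n,\beta_n,K_n}\{|S_n/n|\}\sim\bar y/n^{1/6}\gg m(\beta_n,K_n)$. (d) For $\alpha=\alpha_0=2/3$, $E_{n,\beta_n,K_n}\{|S_n/n|\}\sim\bar z/n^{1/6}\sim\bar z\cdot m(\beta_n,K_n)/\bar x$.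
   Context: Mean-field Blume--Capel model. Let $\Lambda=\{1,0,-1\}$. For $n\in\mathbb N$, $K>0$ and $\omega=(\omega_1,\dots,\omega_n)\in\Lambda^n$ put $S_n(\omega)=\sum_{j=1}^n\omega_j$ and $H_{n,K}(\omega)=\sum_{j=1}^n\omega_j^2-\frac Kn\bigl(\sum_{j=1}^n\omega_j\bigr)^2$. For $\beta>0$, $P_{n,\beta,K}$ is the probability measure on $\Lambda^n$ giving $\omega$ probability proportional to $\exp[-\beta H_{n,K}(\omega)]$; $E_{n,\beta,K}$ denotes expectation with respect to $P_{n,\beta,K}$. Free-energy functional: $c_\beta(t)=\log\frac{1+e^{-\beta}(e^t+e^{-t})}{1+2e^{-\beta}}$ and $G_{\beta,K}(x)=\beta Kx^2-c_\beta(2\beta Kx)$ for $x\in\mathbb R$. $\mathcal M_{\beta,K}$ is the set of global minimum points of $G_{\beta,K}$. Let $\beta_c=\log4$ and $K(\beta)=(e^\beta+2)/(4\beta)$ for $\beta>0$; $K'$ is the derivative of this function. The phase-coexistence region is the set of $(\beta,K)$, $\beta,K>0$, for which $\mathcal M_{\beta,K}$ has more than one element. It is known that for such $(\beta,K)$, $\mathcal M_{\beta,K}$ is $\{\pm m(\beta,K)\}$ or $\{0,\pm m(\beta,K)\}$ with $m(\beta,K)>0$; this unique positive global minimum point $m(\beta,K)$ is the thermodynamic magnetization. Notation: $a_n\sim b_n$ means $a_n/b_n\to1$ and $a_n\gg b_n$ means $a_n/b_n\to\infty$ as $n\to\infty$. All quantities are considered for $n$ large enough that $\beta_n,K_n>0$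 and $(\beta_n,K_n)$ lies in the phase-coexistence region (which holds for all sufficiently large $n$ under the stated assumptions). *)

theory Defs
  imports "HOL-Probability.Probability"
begin

section \<open>The mean-field Blume--Capel model\<close>

definition spins :: "real set" where
  "spins = {1, 0, -1}"

definition configs :: "nat \<Rightarrow> (nat \<Rightarrow> real) set" where
  "configs n = {1..n} \<rightarrow>\<^sub>E spins"

definition total_spin :: "nat \<Rightarrow> (nat \<Rightarrow> real) \<Rightarrow> real" where
  "total_spin n \<omega> = (\<Sum>j = 1..n. \<omega> j)"

definition hamiltonian :: "nat \<Rightarrow> real \<Rightarrow> (nat \<Rightarrow> real) \<Rightarrow> real" where
  "hamiltonian n K \<omega> = (\<Sum>j = 1..n. (\<omega> j)\<^sup>2) - K / real n * (\<Sum>j = 1..n. \<omega> j)\<^sup>2"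

definition partition_fun :: "nat \<Rightarrow> real \<Rightarrow> real \<Rightarrow> real" where
  "partition_fun n \<beta> K = (\<Sum>\<omega>\<in>configs n. exp (- \<beta> * hamiltonian n K \<omega>))"

definition blume_capel :: "nat \<Rightarrow> real \<Rightarrow> real \<Rightarrow> (nat \<Rightarrow> real) measure" where
  "blume_capel n \<beta> K =
     point_measure (configs n)
       (\<lambda>\<omega>. ennreal (exp (- \<beta> * hamiltonian n K \<omega>) / partition_fun n \<beta> K))"

lemma finite_configs: "finite (configs n)"
  by (auto simp: configs_def spins_def intro: finite_PiE)

lemma configs_nonempty: "configs n \<noteq> {}"
  by (auto simp: configs_def spins_def PiE_eq_empty_iff)

lemma partition_fun_pos: "partition_fun n \<beta> K > 0"
  unfolding partition_fun_def
  by (rule sum_pos) (auto simp: finite_configs configs_nonempty)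

lemma prob_space_blume_capel: "prob_space (blume_capel n \<beta> K)"
proof -
  have "(\<Sum>\<omega>\<in>configs n. exp (- \<beta> * hamiltonian n K \<omega>) / partition_fun n \<beta> K) = 1"
    using partition_fun_pos[of n \<beta> K]
    by (simp flip: sum_divide_distrib add: partition_fun_def)
  then have "(\<Sum>\<omega>\<in>configs n.
      ennreal (exp (- \<beta> * hamiltonian n K \<omega>) / partition_fun n \<beta> K)) = 1"
    using partition_fun_pos[of n \<beta> K] by (subst sum_ennreal) (auto simp: less_imp_le)
  then show ?thesis
    by (intro prob_spaceI)
      (simp add: blume_capel_def space_point_measure emeasure_point_measure_finite
        finite_configs)
qed

definition mean_abs_spin :: "nat \<Rightarrow> real \<Rightarrow> real \<Rightarrow> real" where
  "mean_abs_spin n \<beta> K = (\<integral>\<omega>. \<bar>total_spin n \<omega> / real n\<bar> \<partial>blume_capel n \<beta> K)"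


section \<open>Free-energy functional and thermodynamic magnetization\<close>

definition cumulant :: "real \<Rightarrow> real \<Rightarrow> real" where
  "cumulant \<beta> t = ln ((1 + exp (- \<beta>) * (exp t + exp (- t))) / (1 + 2 * exp (- \<beta>)))"

definition free_energy :: "real \<Rightarrow> real \<Rightarrow> real \<Rightarrow> real" where
  "free_energy \<beta> K x = \<beta> * K * x\<^sup>2 - cumulant \<beta> (2 * \<beta> * K * x)"

definition global_minimizers :: "(real \<Rightarrow> real) \<Rightarrow> real set" where
  "global_minimizers f = {x. is_arg_min f (\<lambda>_. True) x}"

definition pos_global_minimizer :: "(real \<Rightarrow> real) \<Rightarrow> real" where
  "pos_global_minimizer f = (THE x. 0 < x \<and> x \<in> global_minimizers f)"

text \<open>
  The magnetization is meaningful on the phase-coexistence region only, i.e. where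
  \<^term>\<open>global_minimizers (free_energy \<beta> K)\<close> has more than one element; there the
  positive global minimum point is unique.
\<close>

definition magnetization :: "real \<Rightarrow> real \<Rightarrow> real" where
  "magnetization \<beta> K = pos_global_minimizer (free_energy \<beta> K)"


section \<open>The tricritical point and the sequences approaching it\<close>

definition beta_c :: real where
  "beta_c = ln 4"

definition K_curve :: "real \<Rightarrow> real" where
  "K_curve \<beta> = (exp \<beta> + 2) / (4 * \<beta>)"

definition beta_seq :: "real \<Rightarrow> real \<Rightarrow> nat \<Rightarrow> real" where
  "beta_seq b \<alpha> n = beta_c + b / real n powr \<alpha>"

definition K_seq :: "real \<Rightarrow> real \<Rightarrow> nat \<Rightarrow> real" where
  "K_seq k \<alpha> n = K_curve beta_c + k / real n powr \<alpha>"

definition c6 :: real where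
  "c6 = 9 / 40"

definition gl_poly :: "real \<Rightarrow> real \<Rightarrow> real \<Rightarrow> real" where
  "gl_poly b k x = beta_c * (deriv K_curve beta_c * b - k) * x\<^sup>2 + c6 * x ^ 6"

definition gl_poly_tilde :: "real \<Rightarrow> real" where
  "gl_poly_tilde x = c6 * x ^ 6"

definition x_bar :: "real \<Rightarrow> real \<Rightarrow> real" where
  "x_bar b k = pos_global_minimizer (gl_poly b k)"

definition gibbs_mean_abs :: "(real \<Rightarrow> real) \<Rightarrow> real" where
  "gibbs_mean_abs f =
     (\<integral>x. \<bar>x\<bar> * exp (- f x) \<partial>lborel) / (\<integral>x. exp (- f x) \<partial>lborel)"

definition y_bar :: real where
  "y_bar = gibbs_mean_abs gl_poly_tilde"

definition z_bar :: "real \<Rightarrow> real \<Rightarrow> real" where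
  "z_bar b k = gibbs_mean_abs (gl_poly b k)"


section \<open>Asymptotic comparison of sequences\<close>

abbreviation seq_sim :: "(nat \<Rightarrow> real) \<Rightarrow> (nat \<Rightarrow> real) \<Rightarrow> bool"  (infix "\<sim>" 50) where
  "a \<sim> b \<equiv> (\<lambda>n. a n / b n) \<longlonglongrightarrow> 1"

abbreviation seq_dominates :: "(nat \<Rightarrow> real) \<Rightarrow> (nat \<Rightarrow> real) \<Rightarrow> bool"  (infix "\<ggreater>" 50) where
  "a \<ggreater> b \<equiv> filterlim (\<lambda>n. a n / b n) at_top sequentially"

end

theory Submission
  imports Defs "HOL-Real_Asymp.Real_Asymp"
begin

text \<open>
  Two facts carry the proof: the finite-size expectation is, up to an error of order \<open>n\<^sup>-\<^sup>1\<^sup>/\<^sup>2\<close>,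
  a ratio of one-dimensional Laplace integrals, and after zooming in at the right scale the free-energy
  functional in these integrals converges to a Ginzburg--Landau polynomial.

  Adding to \<open>S\<^sub>n / n\<close> an independent centred Gaussian of variance \<open>1 / (2 n \<beta> K)\<close> yields a random
  variable with Lebesgue density proportional to \<open>exp (- n G)\<close>, where \<open>G\<close> is the free-energy functional
  (the Hubbard--Stratonovich transformation, lemma \<open>hubbard_stratonovich\<close>). Hence the mean of
  \<open>\<bar>S\<^sub>n / n\<bar>\<close> differs from the Gibbs mean of \<open>\<bar>x\<bar>\<close> under \<open>n G\<close> by at most the mean absolute value of
  the noise (\<open>mean_abs_spin_gibbs_bound\<close>), which is negligible at all scales \<open>n\<^sup>-\<^sup>\<gamma>\<close> with \<open>\<gamma> < 1 / 2\<close>.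

  At the tricritical point the quadratic and quartic Taylor coefficients of \<open>G\<close> vanish and the sextic one is
  \<open>9 / 40\<close>. Along the path both are at most of order \<open>\<epsilon> = n\<^sup>-\<^sup>\<alpha>\<close>. So for a scale \<open>s\<close> with \<open>\<epsilon> / s\<^sup>4\<close>
  tending to \<open>\<kappa>\<close> the zoomed functional \<open>G (s y) / s\<^sup>6\<close> converges pointwise to
  \<open>\<kappa> a y\<^sup>2 + c\<^sub>6 y\<^sup>6\<close>, where \<open>a\<close> is the quadratic coefficient of \<open>gl_poly b k\<close>; its quartic term
  carries an extra factor \<open>s\<^sup>2\<close> and disappears (\<open>zoomed_tendsto\<close>). Part (a) and the slow regime use \<open>s = n\<^sup>-\<^sup>\<alpha>\<^sup>/\<^sup>4\<close>, where \<open>\<kappa> = 1\<close>; the other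
  two regimes use \<open>s = n\<^sup>-\<^sup>1\<^sup>/\<^sup>6\<close>, where \<open>n G\<close> is exactly the zoomed functional and \<open>\<kappa>\<close> is \<open>0\<close> or \<open>1\<close>.

  What makes pointwise convergence sufficient is the shape of \<open>G\<close>. Along the path the numerator of its slope,
  divided by the cube of its argument, is eventually increasing, so \<open>G\<close> is an even double well: decreasing up to the
  magnetization and increasing afterwards (\<open>free_energy_double_well\<close>). Minimizers of double wells
  converge as soon as the functions converge pointwise (\<open>double_well_tendsto\<close>), which is part (a). When
  \<open>n s\<^sup>6\<close> tends to infinity, which is the case \<open>\<alpha> < 2 / 3\<close>, the Gibbs measure concentrates at the two
  bottoms (\<open>gibbs_mean_abs_concentrates\<close>); when \<open>n s\<^sup>6 = 1\<close>, dominated convergence gives the Gibbs mean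
  of the limit polynomial (\<open>gibbs_mean_abs_tendsto\<close>). Both arguments need a lower bound
  \<open>y\<^sup>2 - C\<close> of the zoomed functional that is uniform in \<open>n\<close> (\<open>zoomed_coercive\<close>).
\<close>

section \<open>Even double wells\<close>

definition double_well :: "(real \<Rightarrow> real) \<Rightarrow> real \<Rightarrow> bool" where
  "double_well f m \<longleftrightarrow> 0 < m \<and> (\<forall>x. f (- x) = f x) \<and>
     strict_antimono_on {0..m} f \<and> strict_mono_on {m..} f"

lemma double_well_abs: "double_well f m \<Longrightarrow> f \<bar>x\<bar> = f x"
  by (auto simp: double_well_def abs_if)

lemma double_well_decr: "double_well f m \<Longrightarrow> 0 \<le> x \<Longrightarrow> x < y \<Longrightarrow> y \<le> m \<Longrightarrow> f y < f x"
  by (auto simp: double_well_def monotone_on_def)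

lemma double_well_incr: "double_well f m \<Longrightarrow> m \<le> x \<Longrightarrow> x < y \<Longrightarrow> f x < f y"
  by (auto simp: double_well_def monotone_on_def)

lemma double_well_less:
  assumes "double_well f m" "0 < x" "x \<noteq> m"
  shows "f m < f x"
  using double_well_decr[OF assms(1), of x m] double_well_incr[OF assms(1), of m x] assms
  by (cases "x < m") auto

lemma double_well_minimizer:
  assumes "double_well f m"
  shows "pos_global_minimizer f = m"
proof -
  have m: "0 < m" using assms by (simp add: double_well_def)
  have le: "f m \<le> f x" for x
  proof -
    have "f m \<le> f \<bar>x\<bar>"
      using double_well_less[OF assms, of "\<bar>x\<bar>"] double_well_decr[OF assms, of 0 m] m
      by (cases "x = 0"; cases "\<bar>x\<bar> = m") auto
    then show ?thesis using double_well_abs[OF assms] by simp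
  qed
  show ?thesis
    unfolding pos_global_minimizer_def
  proof (rule the_equality)
    show "0 < m \<and> m \<in> global_minimizers f"
      using m le by (auto simp: global_minimizers_def is_arg_min_def not_less)
    fix x assume "0 < x \<and> x \<in> global_minimizers f"
    then show "x = m"
      using double_well_less[OF assms, of x] by (auto simp: global_minimizers_def is_arg_min_def)
  qed
qed

lemma double_well_rescale:
  assumes "double_well f m" "0 < c" "0 < s"
  shows "double_well (\<lambda>y. c * f (s * y)) (m / s)"
  unfolding double_well_def monotone_on_def
proof (intro conjI allI ballI impI)
  show "0 < m / s" using assms by (simp add: double_well_def)
  show "c * f (s * - x) = c * f (s * x)" for x
    using assms(1) by (simp add: double_well_def)
  show "c * f (s * y) < c * f (s * x)" if "x \<in> {0..m / s}" "y \<in> {0..m / s}" "x < y" for x y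
    using double_well_decr[OF assms(1), of "s * x" "s * y"] assms that
    by (auto simp: field_simps)
  show "c * f (s * x) < c * f (s * y)" if "x \<in> {m / s..}" "y \<in> {m / s..}" "x < y" for x y
    using double_well_incr[OF assms(1), of "s * x" "s * y"] assms that
    by (auto simp: field_simps)
qed

lemma double_well_deriv:
  assumes "0 < m" "\<And>x. f (- x) = f x"
    and D: "\<And>x. (f has_real_derivative f' x) (at x)"
    and neg: "\<And>x. 0 < x \<Longrightarrow> x < m \<Longrightarrow> f' x < 0"
    and pos: "\<And>x. m < x \<Longrightarrow> 0 < f' x"
  shows "double_well f m"
  unfolding double_well_def monotone_on_def
proof (intro conjI allI ballI impI)
  have cont: "continuous_on S f" for S
    using D by (meson DERIV_isCont continuous_at_imp_continuous_on)
  show "f y < f x" if "x \<in> {0..m}" "y \<in> {0..m}" "x < y" for x y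
    using that by (intro DERIV_neg_imp_decreasing_open[of x y f] exI[of _ "f' _"] conjI D neg cont) 
      (auto intro!: exI D neg)
  show "f x < f y" if "x \<in> {m..}" "y \<in> {m..}" "x < y" for x y
    using that by (intro DERIV_pos_imp_increasing_open[of x y f] cont) (auto intro!: exI D pos)
qed (use assms in auto)

text \<open>
  If the bottom of \<open>f n\<close> stayed to the left of some \<open>a < m0\<close>, then \<open>f n\<close> would be increasing on \<open>[a, m0]\<close>,
  although its values at \<open>a\<close> and \<open>m0\<close> are eventually ordered the other way, as in the limit. Monotonicity
  thus replaces the uniform convergence that an argument about minimizers would normally require.
\<close>
lemma double_well_tendsto:
  assumes wn: "\<forall>\<^sub>F n in F. double_well (f n) (m n)"
    and w: "double_well g m0"
    and lim: "\<And>y. ((\<lambda>n. f n y) \<longlongrightarrow> g y) F"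
  shows "(m \<longlongrightarrow> m0) F"
proof (rule order_tendstoI)
  have m0: "0 < m0" using w by (simp add: double_well_def)
  fix a assume a: "a < m0"
  define a' where "a' = (max a 0 + m0) / 2"
  have a': "0 < a'" "a < a'" "a' < m0" using a m0 by (auto simp: a'_def max_def)
  have "g m0 < g a'" using double_well_less[OF w] a' by simp
  then have "\<forall>\<^sub>F n in F. f n m0 < f n a'"
    using order_tendstoD(1)[OF tendsto_diff[OF lim[of a'] lim[of m0]], of 0] by simp
  with wn show "\<forall>\<^sub>F n in F. a < m n"
  proof eventually_elim
    case (elim n)
    show ?case
    proof (rule ccontr)
      assume "\<not> a < m n"
      then have "f n a' < f n m0" using double_well_incr[OF elim(1), of a' m0] a' by auto
      with elim show False by simp
    qed
  qed
next
  have m0: "0 < m0" using w by (simp add: double_well_def)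
  fix a assume a: "m0 < a"
  have "g m0 < g a" using double_well_less[OF w] a m0 by simp
  then have "\<forall>\<^sub>F n in F. f n m0 < f n a"
    using order_tendstoD(1)[OF tendsto_diff[OF lim[of a] lim[of m0]], of 0] by simp
  with wn show "\<forall>\<^sub>F n in F. m n < a"
  proof eventually_elim
    case (elim n)
    show ?case
    proof (rule ccontr)
      assume "\<not> m n < a"
      then have "f n a < f n m0" using double_well_decr[OF elim(1), of m0 a] a m0 by auto
      with elim show False by simp
    qed
  qed
qed

section \<open>Gibbs means: dominated convergence and concentration\<close>

text \<open>
  The majorants for the Gibbs integrals below; up to constants they are moments of the normal
  distribution with variance \<open>1 / 2\<close>.
\<close>
lemma integrable_exp_neg_square: "integrable lborel (\<lambda>y::real. exp (C - y\<^sup>2))"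
  and integrable_abs_exp_neg_square: "integrable lborel (\<lambda>y::real. \<bar>y\<bar> * exp (C - y\<^sup>2))"
proof -
  have eq: "exp (C - y\<^sup>2) = exp C * sqrt pi * normal_density 0 (sqrt (1/2)) y" for y
    by (simp add: normal_density_def exp_diff exp_minus field_simps)
  show "integrable lborel (\<lambda>y::real. exp (C - y\<^sup>2))" unfolding eq by simp
  have "integrable lborel (\<lambda>y. normal_density 0 (sqrt (1/2)) y * \<bar>y - 0\<bar> ^ 1)"
    by (rule integrable_normal_moment_abs) simp
  then have "integrable lborel (\<lambda>y. exp C * sqrt pi * (normal_density 0 (sqrt (1/2)) y * \<bar>y - 0\<bar> ^ 1))"
    by (rule integrable_mult_right)
  then show "integrable lborel (\<lambda>y::real. \<bar>y\<bar> * exp (C - y\<^sup>2))" 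
    unfolding eq by (simp add: mult_ac)
qed

lemma lborel_integral_pos:
  fixes f :: "real \<Rightarrow> real"
  assumes "integrable lborel f" "\<And>x. 0 \<le> f x" "\<And>x. x \<noteq> 0 \<Longrightarrow> 0 < f x"
  shows "0 < (\<integral>x. f x \<partial>lborel)"
proof -
  have "(\<integral>x. f x \<partial>lborel) \<noteq> 0"
  proof
    assume "(\<integral>x. f x \<partial>lborel) = 0"
    then have "AE x in lborel. f x = 0"
      using integral_nonneg_eq_0_iff_AE[OF assms(1)] assms(2) by simp
    moreover have "AE x in lborel. x \<noteq> (0::real)" by (rule AE_lborel_singleton)
    ultimately have "AE x in (lborel::real measure). False"
      by eventually_elim (use assms(3) in force)
    then show False by (simp add: eventually_False ae_filter_eq_bot_iff)
  qed
  moreover have "0 \<le> (\<integral>x. f x \<partial>lborel)" using assms by simp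
  ultimately show ?thesis by simp
qed

context
  fixes f :: "real \<Rightarrow> real" and C :: real
  assumes meas [measurable]: "f \<in> borel_measurable borel"
    and coercive: "\<And>y. y\<^sup>2 - C \<le> f y"
begin

lemma integrable_gibbs: "integrable lborel (\<lambda>y. exp (- f y))"
  using coercive
  by (intro Bochner_Integration.integrable_bound[OF integrable_exp_neg_square[of C]])
     (auto simp: algebra_simps)

lemma integrable_abs_gibbs: "integrable lborel (\<lambda>y. \<bar>y\<bar> * exp (- f y))"
  using coercive
  by (intro Bochner_Integration.integrable_bound[OF integrable_abs_exp_neg_square[of C]])
     (auto simp: algebra_simps abs_mult intro!: mult_left_mono)

lemma gibbs_normalization_pos: "0 < (\<integral>y. exp (- f y) \<partial>lborel)"
  using integrable_gibbs by (rule lborel_integral_pos) auto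

lemma gibbs_mean_abs_pos: "0 < gibbs_mean_abs f"
  unfolding gibbs_mean_abs_def
  using lborel_integral_pos[OF integrable_abs_gibbs] gibbs_normalization_pos by auto

end

lemma gibbs_mean_abs_tendsto:
  assumes [measurable]: "\<And>n. f n \<in> borel_measurable borel" "g \<in> borel_measurable borel"
    and lim: "\<And>y. (\<lambda>n. f n y) \<longlonglongrightarrow> g y"
    and coercive: "\<forall>\<^sub>F n in sequentially. \<forall>y. y\<^sup>2 - C \<le> f n y"
  shows "(\<lambda>n. gibbs_mean_abs (f n)) \<longlonglongrightarrow> gibbs_mean_abs g"
proof -
  obtain N where N: "\<And>n y. N \<le> n \<Longrightarrow> y\<^sup>2 - C \<le> f n y"
    using coercive unfolding eventually_sequentially by blast
  have Cg: "y\<^sup>2 - C \<le> g y" for y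
    by (rule LIMSEQ_le_const[OF lim]) (use N in auto)
  have "(\<lambda>n. \<integral>y. \<bar>y\<bar> * exp (- f (n + N) y) \<partial>lborel) \<longlonglongrightarrow> (\<integral>y. \<bar>y\<bar> * exp (- g y) \<partial>lborel)"
  proof (rule integral_dominated_convergence[where w="\<lambda>y. \<bar>y\<bar> * exp (C - y\<^sup>2)"])
    show "AE y in lborel. norm (\<bar>y\<bar> * exp (- f (n + N) y)) \<le> \<bar>y\<bar> * exp (C - y\<^sup>2)" for n
      using N[of "n + N"] by (intro AE_I2) (auto simp: abs_mult algebra_simps intro!: mult_left_mono)
    show "AE y in lborel. (\<lambda>n. \<bar>y\<bar> * exp (- f (n + N) y)) \<longlonglongrightarrow> \<bar>y\<bar> * exp (- g y)"
      by (intro AE_I2 tendsto_intros LIMSEQ_ignore_initial_segment lim)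
  qed (auto intro: integrable_abs_exp_neg_square)
  moreover have "(\<lambda>n. \<integral>y. exp (- f (n + N) y) \<partial>lborel) \<longlonglongrightarrow> (\<integral>y. exp (- g y) \<partial>lborel)"
  proof (rule integral_dominated_convergence[where w="\<lambda>y. exp (C - y\<^sup>2)"])
    show "AE y in lborel. norm (exp (- f (n + N) y)) \<le> exp (C - y\<^sup>2)" for n
      using N[of "n + N"] by (intro AE_I2) (auto simp: algebra_simps)
    show "AE y in lborel. (\<lambda>n. exp (- f (n + N) y)) \<longlonglongrightarrow> exp (- g y)"
      by (intro AE_I2 tendsto_intros LIMSEQ_ignore_initial_segment lim)
  qed (auto intro: integrable_exp_neg_square)
  moreover have "(\<integral>y. exp (- g y) \<partial>lborel) \<noteq> 0"
    using gibbs_normalization_pos[OF assms(2) Cg] by simp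
  ultimately have "(\<lambda>n. gibbs_mean_abs (f (n + N))) \<longlonglongrightarrow> gibbs_mean_abs g"
    unfolding gibbs_mean_abs_def by (intro tendsto_divide)
  then show ?thesis by (rule LIMSEQ_offset)
qed

lemma gibbs_mean_abs_rescale:
  assumes "0 < s"
  shows "gibbs_mean_abs f = s * gibbs_mean_abs (\<lambda>y. f (s * y))"
proof -
  have "(\<integral>x. \<bar>x\<bar> * exp (- f x) \<partial>lborel) = s * (\<integral>y. \<bar>s * y\<bar> * exp (- f (s * y)) \<partial>lborel)"
    using lborel_integral_real_affine[of s "\<lambda>x. \<bar>x\<bar> * exp (- f x)" 0] assms by simp
  also have "(\<integral>y. \<bar>s * y\<bar> * exp (- f (s * y)) \<partial>lborel) = s * (\<integral>y. \<bar>y\<bar> * exp (- f (s * y)) \<partial>lborel)"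
    using assms by (simp add: abs_mult mult.assoc)
  finally have 1: "(\<integral>x. \<bar>x\<bar> * exp (- f x) \<partial>lborel) = s * (s * (\<integral>y. \<bar>y\<bar> * exp (- f (s * y)) \<partial>lborel))" .
  have 2: "(\<integral>x. exp (- f x) \<partial>lborel) = s * (\<integral>y. exp (- f (s * y)) \<partial>lborel)"
    using lborel_integral_real_affine[of s "\<lambda>x. exp (- f x)" 0] assms by simp
  show ?thesis unfolding gibbs_mean_abs_def 1 2 using assms by simp
qed

text \<open>
  A Laplace estimate with explicit constants. Away from the bottoms, \<open>f\<close> is at least \<open>e2\<close>: there one factor
  \<open>exp (- f)\<close> is kept for integrability and the other \<open>L - 1\<close> are bounded by \<open>exp (- e2)\<close>. On the interval
  \<open>[m0, m0 + \<delta>]\<close>, \<open>f\<close> is at most \<open>e1\<close>, which bounds the normalization from below. By monotonicity each of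
  these bounds on \<open>f\<close> follows from its values at two points, so that pointwise convergence of a sequence
  of wells supplies the hypotheses.
\<close>
lemma gibbs_mean_abs_concentration_bound:
  assumes w: "double_well f m" and [measurable]: "f \<in> borel_measurable borel"
    and coercive: "\<And>y. y\<^sup>2 - C \<le> f y"
    and m: "m0 - \<eta> < m" "m < m0 + \<eta>" and \<eta>: "0 < \<eta>" "\<eta> < m0" and \<delta>: "0 < \<delta>"
    and low: "f m0 \<le> e1" "f (m0 + \<delta>) \<le> e1"
    and high: "e2 \<le> f (m0 - \<eta>)" "e2 \<le> f (m0 + \<eta>)"
    and L: "1 \<le> L"
  shows "\<bar>gibbs_mean_abs (\<lambda>y. L * f y) - m0\<bar>
    \<le> \<eta> + (\<integral>y. \<bar>\<bar>y\<bar> - m0\<bar> * exp (C - y\<^sup>2) \<partial>lborel) / \<delta> * exp e2 * exp (- (L * (e2 - e1)))"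
proof -
  \<comment> \<open>Coercivity of \<open>L * f\<close>: one copy of \<open>f\<close> supplies \<open>y\<^sup>2 - C\<close>, the others are at least \<open>f m\<close>.\<close>
  have co: "y\<^sup>2 - (C - (L - 1) * f m) \<le> L * f y" for y
  proof -
    have "f m \<le> f \<bar>y\<bar>"
      using double_well_less[OF w, of "\<bar>y\<bar>"] double_well_decr[OF w, of 0 m] w
      by (cases "y = 0"; cases "\<bar>y\<bar> = m") (auto simp: double_well_def)
    then have "(L - 1) * f m \<le> (L - 1) * f y"
      using L double_well_abs[OF w] by (intro mult_left_mono) auto
    then show ?thesis using coercive[of y] by (simp add: algebra_simps)
  qed
  have Lm [measurable]: "(\<lambda>y. L * f y) \<in> borel_measurable borel" by simp
  note int = integrable_gibbs[OF Lm co] and inta = integrable_abs_gibbs[OF Lm co]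
  define D where "D = (\<integral>y. exp (- (L * f y)) \<partial>lborel)"
  define B where "B = (\<integral>y. \<bar>\<bar>y\<bar> - m0\<bar> * exp (C - y\<^sup>2) \<partial>lborel)"
  have Dpos: "0 < D" unfolding D_def by (rule gibbs_normalization_pos[OF Lm co])
  have iB: "integrable lborel (\<lambda>y. \<bar>\<bar>y\<bar> - m0\<bar> * exp (C - y\<^sup>2))"
    by (rule Bochner_Integration.integrable_bound
        [OF Bochner_Integration.integrable_add[OF integrable_abs_exp_neg_square[of C]
              integrable_mult_right[OF integrable_exp_neg_square[of C], of "\<bar>m0\<bar>"]]])
       (auto simp: abs_mult simp flip: distrib_right intro!: mult_right_mono)
  have B0: "0 \<le> B" unfolding B_def by simp
  have far: "e2 \<le> f y" if "\<eta> \<le> \<bar>\<bar>y\<bar> - m0\<bar>" for y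
  proof -
    have "e2 \<le> f \<bar>y\<bar>"
    proof (cases "\<bar>y\<bar> \<le> m0 - \<eta>")
      case True
      then show ?thesis using high double_well_decr[OF w, of "\<bar>y\<bar>" "m0 - \<eta>"] m
        by (cases "\<bar>y\<bar> = m0 - \<eta>") auto
    next
      case False
      then have "m0 + \<eta> \<le> \<bar>y\<bar>" using that by auto
      then show ?thesis using high double_well_incr[OF w, of "m0 + \<eta>" "\<bar>y\<bar>"] m
        by (cases "\<bar>y\<bar> = m0 + \<eta>") auto
    qed
    then show ?thesis using double_well_abs[OF w] by simp
  qed
  have near: "f y \<le> e1" if "y \<in> {m0..m0 + \<delta>}" for y
  proof (cases "y \<le> m")
    case True
    then show ?thesis using double_well_decr[OF w, of m0 y] low that \<eta> by (cases "y = m0") auto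
  next
    case False
    then show ?thesis using double_well_incr[OF w, of y "m0 + \<delta>"] low that by (cases "y = m0 + \<delta>") auto
  qed
  have Dlow: "\<delta> * exp (- (L * e1)) \<le> D"
  proof -
    have "(\<integral>y. exp (- (L * e1)) * indicator {m0..m0 + \<delta>} y \<partial>lborel) \<le> D"
      unfolding D_def
    proof (rule integral_mono)
      show "integrable lborel (\<lambda>y. exp (- (L * f y)))" by (rule int)
      show "exp (- (L * e1)) * indicator {m0..m0 + \<delta>} y \<le> exp (- (L * f y))" for y
        using near[of y] L by (auto simp: indicator_def intro!: mult_left_mono)
      show "integrable lborel (\<lambda>y. exp (- (L * e1)) * indicator {m0..m0 + \<delta>} y)"
        by (intro integrable_mult_right integrable_real_indicator) (auto simp: emeasure_lborel_Icc_eq)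
    qed
    then show ?thesis using \<delta> by (simp add: mult.commute)
  qed
  have pw: "\<bar>\<bar>y\<bar> - m0\<bar> * exp (- (L * f y))
      \<le> \<eta> * exp (- (L * f y)) + exp (- ((L - 1) * e2)) * (\<bar>\<bar>y\<bar> - m0\<bar> * exp (C - y\<^sup>2))" for y
  proof (cases "\<eta> \<le> \<bar>\<bar>y\<bar> - m0\<bar>")
    case True
    have "(L - 1) * e2 \<le> (L - 1) * f y" using far[OF True] L by (intro mult_left_mono) auto
    then have "exp (- (L * f y)) \<le> exp (- ((L - 1) * e2) + (C - y\<^sup>2))"
      using coercive[of y] by (simp add: algebra_simps)
    then have "\<bar>\<bar>y\<bar> - m0\<bar> * exp (- (L * f y)) \<le> \<bar>\<bar>y\<bar> - m0\<bar> * (exp (- ((L - 1) * e2)) * exp (C - y\<^sup>2))"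
      by (intro mult_left_mono) (simp_all only: exp_add abs_ge_zero)
    also have "\<dots> \<le> \<eta> * exp (- (L * f y)) + exp (- ((L - 1) * e2)) * (\<bar>\<bar>y\<bar> - m0\<bar> * exp (C - y\<^sup>2))"
      using \<eta> by (simp add: algebra_simps)
    finally show ?thesis .
  next
    case False
    then have "\<bar>\<bar>y\<bar> - m0\<bar> * exp (- (L * f y)) \<le> \<eta> * exp (- (L * f y))" by (intro mult_right_mono) auto
    also have "\<dots> \<le> \<eta> * exp (- (L * f y)) + exp (- ((L - 1) * e2)) * (\<bar>\<bar>y\<bar> - m0\<bar> * exp (C - y\<^sup>2))"
      by simp
    finally show ?thesis .
  qed
  have intd: "integrable lborel (\<lambda>y. \<bar>\<bar>y\<bar> - m0\<bar> * exp (- (L * f y)))"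
    by (rule Bochner_Integration.integrable_bound
        [OF Bochner_Integration.integrable_add[OF inta integrable_mult_right[OF int, of "\<bar>m0\<bar>"]]])
       (auto simp: abs_mult simp flip: distrib_right intro!: mult_right_mono)
  have "(\<integral>y. \<bar>\<bar>y\<bar> - m0\<bar> * exp (- (L * f y)) \<partial>lborel)
      \<le> (\<integral>y. \<eta> * exp (- (L * f y)) + exp (- ((L - 1) * e2)) * (\<bar>\<bar>y\<bar> - m0\<bar> * exp (C - y\<^sup>2)) \<partial>lborel)"
    by (intro integral_mono pw intd Bochner_Integration.integrable_add integrable_mult_right int iB)
  also have "\<dots> = \<eta> * D + exp (- ((L - 1) * e2)) * B"
    unfolding D_def B_def using int iB by simp
  finally have up: "(\<integral>y. \<bar>\<bar>y\<bar> - m0\<bar> * exp (- (L * f y)) \<partial>lborel) \<le> \<eta> * D + exp (- ((L - 1) * e2)) * B" .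
  have "gibbs_mean_abs (\<lambda>y. L * f y) - m0 = ((\<integral>y. \<bar>y\<bar> * exp (- (L * f y)) \<partial>lborel) - m0 * D) / D"
    using Dpos by (simp add: gibbs_mean_abs_def D_def diff_divide_distrib)
  also have "(\<integral>y. \<bar>y\<bar> * exp (- (L * f y)) \<partial>lborel) - m0 * D = (\<integral>y. (\<bar>y\<bar> - m0) * exp (- (L * f y)) \<partial>lborel)"
    unfolding D_def using int inta by (simp add: left_diff_distrib)
  finally have "\<bar>gibbs_mean_abs (\<lambda>y. L * f y) - m0\<bar> = \<bar>\<integral>y. (\<bar>y\<bar> - m0) * exp (- (L * f y)) \<partial>lborel\<bar> / D"
    using Dpos by simp
  also have "\<dots> \<le> (\<integral>y. \<bar>\<bar>y\<bar> - m0\<bar> * exp (- (L * f y)) \<partial>lborel) / D"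
    using integral_abs_bound[of lborel "\<lambda>y. (\<bar>y\<bar> - m0) * exp (- (L * f y))"] Dpos
    by (intro divide_right_mono) (auto simp: abs_mult)
  also have "\<dots> \<le> (\<eta> * D + exp (- ((L - 1) * e2)) * B) / D"
    using up Dpos by (intro divide_right_mono) auto
  also have "\<dots> = \<eta> + exp (- ((L - 1) * e2)) * B / D" using Dpos by (simp add: field_simps)
  also have "\<dots> \<le> \<eta> + exp (- ((L - 1) * e2)) * B / (\<delta> * exp (- (L * e1)))"
    using Dlow B0 Dpos \<delta> by (intro add_left_mono divide_left_mono mult_nonneg_nonneg mult_pos_pos) auto
  also have "exp (- ((L - 1) * e2)) * B / (\<delta> * exp (- (L * e1))) = B / \<delta> * (exp (- ((L - 1) * e2)) / exp (- (L * e1)))"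
    by simp
  also have "exp (- ((L - 1) * e2)) / exp (- (L * e1)) = exp e2 * exp (- (L * (e2 - e1)))"
    unfolding exp_add[symmetric] exp_diff[symmetric] by (simp add: algebra_simps)
  finally show ?thesis by (simp add: B_def mult.assoc)
qed

text \<open>
  The levels \<open>e1 < e2\<close> are put at one and two thirds of the gap between the minimum of \<open>g\<close> and its
  values at distance \<open>\<eta>\<close> from the minimum point, which leaves room for the convergence error on either side.
\<close>
lemma gibbs_mean_abs_concentrates:
  assumes wn: "\<forall>\<^sub>F n in sequentially. double_well (f n) (m n)"
    and w: "double_well g m0" and cont: "isCont g m0"
    and meas: "\<And>n. f n \<in> borel_measurable borel"
    and lim: "\<And>y. (\<lambda>n. f n y) \<longlonglongrightarrow> g y"
    and coercive: "\<forall>\<^sub>F n in sequentially. \<forall>y. y\<^sup>2 - C \<le> f n y"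
    and L: "filterlim L at_top sequentially"
  shows "(\<lambda>n. gibbs_mean_abs (\<lambda>y. L n * f n y)) \<longlonglongrightarrow> m0"
proof (rule tendstoI)
  have m0: "0 < m0" using w by (simp add: double_well_def)
  fix e :: real assume e: "0 < e"
  define \<eta> where "\<eta> = min (e / 2) (m0 / 2)"
  have \<eta>: "0 < \<eta>" "\<eta> < m0" "\<eta> \<le> e / 2" using e m0 by (auto simp: \<eta>_def min_def)
  define h where "h = min (g (m0 - \<eta>)) (g (m0 + \<eta>))"
  have h: "g m0 < h" unfolding h_def
    using double_well_less[OF w, of "m0 - \<eta>"] double_well_less[OF w, of "m0 + \<eta>"] \<eta> by auto
  define e1 where "e1 = g m0 + (h - g m0) / 3"
  define e2 where "e2 = g m0 + 2 * (h - g m0) / 3"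
  have e12: "g m0 < e1" "e1 < e2" "e2 < h" using h by (auto simp: e1_def e2_def field_simps)
  obtain \<delta> where \<delta>: "0 < \<delta>" "g (m0 + \<delta>) < e1"
  proof -
    have "\<forall>\<^sub>F x in at m0. g x < e1"
      using cont e12 unfolding isCont_def by (intro order_tendstoD(2)[of g "g m0"]) auto
    then obtain d where d: "0 < d" "\<And>x. x \<noteq> m0 \<Longrightarrow> dist x m0 < d \<Longrightarrow> g x < e1"
      unfolding eventually_at by auto
    show thesis by (rule that[of "d / 2"]) (use d in \<open>auto simp: dist_real_def\<close>)
  qed
  define B where "B = (\<integral>y. \<bar>\<bar>y\<bar> - m0\<bar> * exp (C - y\<^sup>2) \<partial>lborel)"
  have mn: "m \<longlonglongrightarrow> m0" by (rule double_well_tendsto[OF wn w lim])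
  have small: "((\<lambda>n. B / \<delta> * exp e2 * exp (- (L n * (e2 - e1)))) \<longlongrightarrow> B / \<delta> * exp e2 * 0) sequentially"
    using L e12 by (intro tendsto_mult tendsto_const filterlim_compose[OF exp_at_bot]
        filterlim_compose[OF filterlim_uminus_at_bot_at_top]
        filterlim_at_top_mult_tendsto_pos[of _ "e2 - e1"]) (auto simp: mult.commute)
  have "\<forall>\<^sub>F n in sequentially. B / \<delta> * exp e2 * exp (- (L n * (e2 - e1))) < e / 2"
    using order_tendstoD(2)[OF small, of "e / 2"] e by simp
  moreover have "\<forall>\<^sub>F n in sequentially. m0 - \<eta> < m n" "\<forall>\<^sub>F n in sequentially. m n < m0 + \<eta>"
    using order_tendstoD[OF mn] \<eta> by auto
  moreover have "\<forall>\<^sub>F n in sequentially. f n m0 < e1" "\<forall>\<^sub>F n in sequentially. f n (m0 + \<delta>) < e1"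
    using order_tendstoD(2)[OF lim] e12 \<delta> by auto
  moreover have "\<forall>\<^sub>F n in sequentially. e2 < f n (m0 - \<eta>)" "\<forall>\<^sub>F n in sequentially. e2 < f n (m0 + \<eta>)"
    using order_tendstoD(1)[OF lim] e12 by (auto simp: h_def)
  moreover have "\<forall>\<^sub>F n in sequentially. 1 \<le> L n"
    using L unfolding filterlim_at_top by blast
  ultimately show "\<forall>\<^sub>F n in sequentially. dist (gibbs_mean_abs (\<lambda>y. L n * f n y)) m0 < e"
    using wn coercive
  proof eventually_elim
    case (elim n)
    have "\<bar>gibbs_mean_abs (\<lambda>y. L n * f n y) - m0\<bar>
        \<le> \<eta> + B / \<delta> * exp e2 * exp (- (L n * (e2 - e1)))"
      unfolding B_def
      by (rule gibbs_mean_abs_concentration_bound[where m="m n"]) (use elim \<eta> \<delta> meas in auto)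
    then show ?case
      using elim(1) \<eta>(3) unfolding dist_real_def by linarith
  qed
qed

section \<open>Gaussian smoothing of the total spin\<close>

lemma mean_abs_spin_eq:
  "mean_abs_spin n \<beta> K =
     (\<Sum>\<omega>\<in>configs n. exp (- \<beta> * hamiltonian n K \<omega>) * \<bar>total_spin n \<omega> / real n\<bar>) / partition_fun n \<beta> K"
proof -
  have "mean_abs_spin n \<beta> K =
      (\<Sum>\<omega>\<in>configs n. (exp (- \<beta> * hamiltonian n K \<omega>) / partition_fun n \<beta> K) * \<bar>total_spin n \<omega> / real n\<bar>)"
    unfolding mean_abs_spin_def blume_capel_def
    using partition_fun_pos[of n \<beta> K]
    by (subst lebesgue_integral_point_measure_finite) (auto simp: finite_configs less_imp_le)
  then show ?thesis by (simp only: sum_divide_distrib times_divide_eq_left)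
qed

text \<open>
  The reverse triangle inequality, integrated: replacing the absolute mean of a Gaussian by the absolute
  value of its centre costs at most the first absolute central moment.
\<close>
lemma normal_density_abs_moment:
  assumes "0 < \<sigma>"
  shows "integrable lborel (\<lambda>x. \<bar>x\<bar> * normal_density s \<sigma> x)"
    and "\<bar>(\<integral>x. \<bar>x\<bar> * normal_density s \<sigma> x \<partial>lborel) - \<bar>s\<bar>\<bar> \<le> \<sigma> * sqrt (2 / pi)"
proof -
  have i0: "integrable lborel (normal_density s \<sigma>)" using assms by simp
  have i1: "integrable lborel (\<lambda>x. normal_density s \<sigma> x * \<bar>x - s\<bar>)"
    and m1: "(\<integral>x. normal_density s \<sigma> x * \<bar>x - s\<bar> \<partial>lborel) = \<sigma> * sqrt (2 / pi)"
    using integrable_normal_moment_abs[OF assms, of s 1] integral_normal_moment_abs_odd[OF assms, of s 0]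
    by simp_all
  show i: "integrable lborel (\<lambda>x. \<bar>x\<bar> * normal_density s \<sigma> x)"
  proof (rule Bochner_Integration.integrable_bound
      [OF Bochner_Integration.integrable_add[OF i1 integrable_mult_right[OF i0, of "\<bar>s\<bar>"]]])
    show "AE x in lborel. norm (\<bar>x\<bar> * normal_density s \<sigma> x)
        \<le> norm (normal_density s \<sigma> x * \<bar>x - s\<bar> + \<bar>s\<bar> * normal_density s \<sigma> x)"
    proof (rule AE_I2)
      fix x
      have "\<bar>x\<bar> * normal_density s \<sigma> x \<le> (\<bar>x - s\<bar> + \<bar>s\<bar>) * normal_density s \<sigma> x"
        by (rule mult_right_mono) auto
      then show "norm (\<bar>x\<bar> * normal_density s \<sigma> x)
          \<le> norm (normal_density s \<sigma> x * \<bar>x - s\<bar> + \<bar>s\<bar> * normal_density s \<sigma> x)"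
        by (simp add: algebra_simps abs_mult)
    qed
  qed simp
  have "(\<integral>x. \<bar>x\<bar> * normal_density s \<sigma> x \<partial>lborel) - \<bar>s\<bar>
      = (\<integral>x. \<bar>x\<bar> * normal_density s \<sigma> x - \<bar>s\<bar> * normal_density s \<sigma> x \<partial>lborel)"
    using i i0 assms by simp
  also have "\<bar>\<dots>\<bar> \<le> (\<integral>x. \<bar>\<bar>x\<bar> * normal_density s \<sigma> x - \<bar>s\<bar> * normal_density s \<sigma> x\<bar> \<partial>lborel)"
    by (rule integral_abs_bound)
  also have "\<dots> \<le> (\<integral>x. normal_density s \<sigma> x * \<bar>x - s\<bar> \<partial>lborel)"
  proof (rule integral_mono)
    show "\<bar>\<bar>x\<bar> * normal_density s \<sigma> x - \<bar>s\<bar> * normal_density s \<sigma> x\<bar> \<le> normal_density s \<sigma> x * \<bar>x - s\<bar>" for x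
    proof -
      have "\<bar>\<bar>x\<bar> - \<bar>s\<bar>\<bar> * normal_density s \<sigma> x \<le> \<bar>x - s\<bar> * normal_density s \<sigma> x"
        by (rule mult_right_mono) auto
      moreover have "\<bar>\<bar>x\<bar> * normal_density s \<sigma> x - \<bar>s\<bar> * normal_density s \<sigma> x\<bar> = \<bar>\<bar>x\<bar> - \<bar>s\<bar>\<bar> * normal_density s \<sigma> x"
        by (simp add: abs_mult flip: left_diff_distrib)
      ultimately show ?thesis by (simp add: mult.commute)
    qed
  qed (use i i0 i1 in auto)
  finally show "\<bar>(\<integral>x. \<bar>x\<bar> * normal_density s \<sigma> x \<partial>lborel) - \<bar>s\<bar>\<bar> \<le> \<sigma> * sqrt (2 / pi)"
    using m1 by simp
qed

lemma single_spin_sum: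
  "(\<Sum>s\<in>spins. exp (- \<beta> * s\<^sup>2 + t * s)) = (1 + 2 * exp (- \<beta>)) * exp (cumulant \<beta> t)"
proof -
  have "(\<Sum>s\<in>spins. exp (- \<beta> * s\<^sup>2 + t * s)) = 1 + exp (- \<beta>) * (exp t + exp (- t))"
    by (simp add: spins_def exp_add algebra_simps) (simp flip: exp_add)
  moreover have "0 < (1 + exp (- \<beta>) * (exp t + exp (- t))) / (1 + 2 * exp (- \<beta>))"
    by (intro divide_pos_pos add_pos_pos mult_pos_pos) auto
  moreover have "1 + 2 * exp (- \<beta>) \<noteq> 0" using exp_gt_zero[of "- \<beta>"] by linarith
  ultimately show ?thesis unfolding cumulant_def by (simp only: exp_ln) simp
qed

text \<open>
  Completing the square: in the exponent the Gaussian centred at \<open>S\<^sub>n / n\<close> cancels the interaction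
  \<open>\<beta> K S\<^sub>n\<^sup>2 / n\<close> and leaves a term linear in \<open>S\<^sub>n\<close>. The spins then decouple, and the sum over
  configurations factorizes into \<open>n\<close> identical single-spin sums, each of them a constant times
  \<open>exp (c\<^sub>\<beta> (2 \<beta> K x))\<close>.
\<close>
lemma hubbard_stratonovich:
  assumes n: "0 < n" and "0 < \<beta>" "0 < K"
  defines "\<sigma> \<equiv> 1 / sqrt (2 * real n * \<beta> * K)"
  shows "(\<Sum>\<omega>\<in>configs n. exp (- \<beta> * hamiltonian n K \<omega>) * normal_density (total_spin n \<omega> / real n) \<sigma> x)
     = 1 / sqrt (2 * pi * \<sigma>\<^sup>2) * (1 + 2 * exp (- \<beta>)) ^ n * exp (- (real n * free_energy \<beta> K x))"
proof -
  define t where "t = 2 * \<beta> * K * x"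
  have \<sigma>: "\<sigma>\<^sup>2 = 1 / (2 * real n * \<beta> * K)"
    using assms by (simp add: \<sigma>_def power_divide)
  have "exp (- \<beta> * hamiltonian n K \<omega>) * normal_density (total_spin n \<omega> / real n) \<sigma> x
      = 1 / sqrt (2 * pi * \<sigma>\<^sup>2) * exp (- (real n * \<beta> * K * x\<^sup>2)) * (\<Prod>j = 1..n. exp (- \<beta> * (\<omega> j)\<^sup>2 + t * \<omega> j))" for \<omega>
  proof -
    define S where "S = (\<Sum>j = 1..n. \<omega> j)"
    define Q where "Q = (\<Sum>j = 1..n. (\<omega> j)\<^sup>2)"
    have "(\<Prod>j = 1..n. exp (- \<beta> * (\<omega> j)\<^sup>2 + t * \<omega> j)) = exp (- \<beta> * Q + t * S)"
      by (simp add: exp_sum[symmetric] sum.distrib sum_distrib_left sum_subtractf sum_negf Q_def S_def)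
    moreover have "- \<beta> * (Q - K / real n * S\<^sup>2) - (x - S / real n)\<^sup>2 / (2 * \<sigma>\<^sup>2)
        = - (real n * \<beta> * K * x\<^sup>2) + (- \<beta> * Q + t * S)"
      unfolding \<sigma> t_def using assms by (simp add: field_simps power2_eq_square)
    then have "exp (- \<beta> * (Q - K / real n * S\<^sup>2)) * exp (- (x - S / real n)\<^sup>2 / (2 * \<sigma>\<^sup>2))
        = exp (- (real n * \<beta> * K * x\<^sup>2)) * exp (- \<beta> * Q + t * S)"
      unfolding exp_add[symmetric] by (simp add: exp_add[symmetric])
    ultimately show ?thesis
      unfolding normal_density_def hamiltonian_def total_spin_def S_def[symmetric] Q_def[symmetric]
      by simp
  qed
  then have "(\<Sum>\<omega>\<in>configs n. exp (- \<beta> * hamiltonian n K \<omega>) * normal_density (total_spin n \<omega> / real n) \<sigma> x)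
      = 1 / sqrt (2 * pi * \<sigma>\<^sup>2) * exp (- (real n * \<beta> * K * x\<^sup>2)) *
        (\<Sum>\<omega>\<in>configs n. \<Prod>j = 1..n. exp (- \<beta> * (\<omega> j)\<^sup>2 + t * \<omega> j))"
    by (simp add: sum_distrib_left)
  also have "(\<Sum>\<omega>\<in>configs n. \<Prod>j = 1..n. exp (- \<beta> * (\<omega> j)\<^sup>2 + t * \<omega> j))
      = (\<Prod>j = 1..n. \<Sum>s\<in>spins. exp (- \<beta> * s\<^sup>2 + t * s))"
    unfolding configs_def by (subst prod_sum_PiE) (auto simp: spins_def)
  also have "\<dots> = (1 + 2 * exp (- \<beta>)) ^ n * exp (real n * cumulant \<beta> t)"
    unfolding single_spin_sum by (simp add: power_mult_distrib exp_of_nat_mult)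
  finally show ?thesis
    by (simp add: free_energy_def t_def algebra_simps exp_diff exp_minus)
       (simp add: field_simps exp_diff exp_add exp_minus)
qed

lemma mean_abs_spin_gibbs_bound:
  assumes n: "0 < n" and "0 < \<beta>" "0 < K"
  shows "\<bar>mean_abs_spin n \<beta> K - gibbs_mean_abs (\<lambda>x. real n * free_energy \<beta> K x)\<bar>
     \<le> 1 / sqrt (pi * real n * \<beta> * K)"
proof -
  define \<sigma> where "\<sigma> = 1 / sqrt (2 * real n * \<beta> * K)"
  have \<sigma>: "0 < \<sigma>" using assms by (simp add: \<sigma>_def)
  define c where "c = 1 / sqrt (2 * pi * \<sigma>\<^sup>2) * (1 + 2 * exp (- \<beta>)) ^ n"
  have c: "0 < c" unfolding c_def using \<sigma> by (intro mult_pos_pos divide_pos_pos zero_less_power add_pos_pos) auto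
  define w where "w \<omega> = exp (- \<beta> * hamiltonian n K \<omega>)" for \<omega>
  define N where "N \<omega> = normal_density (total_spin n \<omega> / real n) \<sigma>" for \<omega>
  define Z where "Z = partition_fun n \<beta> K"
  have Z: "0 < Z" unfolding Z_def by (rule partition_fun_pos)
  have mix: "c * exp (- (real n * free_energy \<beta> K x)) = (\<Sum>\<omega>\<in>configs n. w \<omega> * N \<omega> x)" for x
    using hubbard_stratonovich[OF assms, of x] by (simp add: c_def w_def N_def \<sigma>_def)
  have iN: "integrable lborel (N \<omega>)" "integrable lborel (\<lambda>x. \<bar>x\<bar> * N \<omega> x)" for \<omega>
    unfolding N_def using \<sigma> normal_density_abs_moment(1) by auto
  have "c * (\<integral>x. exp (- (real n * free_energy \<beta> K x)) \<partial>lborel) = (\<integral>x. (\<Sum>\<omega>\<in>configs n. w \<omega> * N \<omega> x) \<partial>lborel)"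
    by (simp flip: mix)
  also have "\<dots> = (\<Sum>\<omega>\<in>configs n. w \<omega> * (\<integral>x. N \<omega> x \<partial>lborel))"
    using iN by (subst Bochner_Integration.integral_sum) auto
  also have "\<dots> = Z" using \<sigma> by (simp add: N_def Z_def partition_fun_def w_def)
  finally have den: "c * (\<integral>x. exp (- (real n * free_energy \<beta> K x)) \<partial>lborel) = Z" .
  have "c * (\<integral>x. \<bar>x\<bar> * exp (- (real n * free_energy \<beta> K x)) \<partial>lborel)
      = (\<integral>x. \<bar>x\<bar> * (c * exp (- (real n * free_energy \<beta> K x))) \<partial>lborel)"
    by (simp add: mult_ac)
  also have "\<dots> = (\<integral>x. (\<Sum>\<omega>\<in>configs n. w \<omega> * (\<bar>x\<bar> * N \<omega> x)) \<partial>lborel)"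
    by (simp add: mix sum_distrib_left mult_ac)
  also have "\<dots> = (\<Sum>\<omega>\<in>configs n. w \<omega> * (\<integral>x. \<bar>x\<bar> * N \<omega> x \<partial>lborel))"
    using iN by (subst Bochner_Integration.integral_sum) auto
  finally have num: "c * (\<integral>x. \<bar>x\<bar> * exp (- (real n * free_energy \<beta> K x)) \<partial>lborel)
      = (\<Sum>\<omega>\<in>configs n. w \<omega> * (\<integral>x. \<bar>x\<bar> * N \<omega> x \<partial>lborel))" .
  have "gibbs_mean_abs (\<lambda>x. real n * free_energy \<beta> K x)
      = (c * (\<integral>x. \<bar>x\<bar> * exp (- (real n * free_energy \<beta> K x)) \<partial>lborel))
        / (c * (\<integral>x. exp (- (real n * free_energy \<beta> K x)) \<partial>lborel))"
    using c by (simp add: gibbs_mean_abs_def)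
  also have "\<dots> = (\<Sum>\<omega>\<in>configs n. w \<omega> * (\<integral>x. \<bar>x\<bar> * N \<omega> x \<partial>lborel)) / Z"
    by (simp only: num den)
  finally have "\<bar>mean_abs_spin n \<beta> K - gibbs_mean_abs (\<lambda>x. real n * free_energy \<beta> K x)\<bar>
      = \<bar>\<Sum>\<omega>\<in>configs n. w \<omega> * (\<bar>total_spin n \<omega> / real n\<bar> - (\<integral>x. \<bar>x\<bar> * N \<omega> x \<partial>lborel))\<bar> / Z"
    using Z unfolding mean_abs_spin_eq w_def[symmetric] Z_def[symmetric]
    by (simp add: right_diff_distrib sum_subtractf flip: diff_divide_distrib)
  also have "\<dots> \<le> (\<Sum>\<omega>\<in>configs n. w \<omega> * (\<sigma> * sqrt (2 / pi))) / Z"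
  proof (intro divide_right_mono order_trans[OF sum_abs] sum_mono)
    fix \<omega>
    have "\<bar>\<bar>total_spin n \<omega> / real n\<bar> - (\<integral>x. \<bar>x\<bar> * N \<omega> x \<partial>lborel)\<bar> \<le> \<sigma> * sqrt (2 / pi)"
      using normal_density_abs_moment(2)[OF \<sigma>, of "total_spin n \<omega> / real n"]
      unfolding N_def by linarith
    then show "\<bar>w \<omega> * (\<bar>total_spin n \<omega> / real n\<bar> - (\<integral>x. \<bar>x\<bar> * N \<omega> x \<partial>lborel))\<bar> \<le> w \<omega> * (\<sigma> * sqrt (2 / pi))"
      unfolding abs_mult by (simp add: w_def mult_left_mono)
  qed (use Z in simp)
  also have "\<dots> = \<sigma> * sqrt (2 / pi)"
    using Z by (simp flip: sum_distrib_right) (simp add: Z_def partition_fun_def w_def)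
  also have "\<dots> = 1 / sqrt (pi * real n * \<beta> * K)"
    by (simp add: \<sigma>_def real_sqrt_mult real_sqrt_divide)
  finally show ?thesis .
qed

section \<open>Shape and growth of the free-energy functional\<close>

text \<open>
  The probability that a single free spin is nonzero. With \<open>p = active_fraction \<beta>\<close> the cumulant is
  \<open>ln (1 + p (cosh t - 1))\<close>, and \<open>2 \<beta> K p = K / K_curve \<beta>\<close>; the tricritical point is \<open>p = 1 / 3\<close>,
  \<open>2 \<beta> K = 3\<close>.
\<close>
definition active_fraction :: "real \<Rightarrow> real" where
  "active_fraction \<beta> = 2 / (exp \<beta> + 2)"

text \<open>
  The derivative of the free-energy functional at \<open>x\<close> is this function, with \<open>r = 2 \<beta> K\<close> and \<open>t = r x\<close>,
  divided by the positive factor \<open>1 + p (cosh t - 1)\<close>.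
\<close>
definition slope_numerator :: "real \<Rightarrow> real \<Rightarrow> real \<Rightarrow> real" where
  "slope_numerator p r t = (1 - p + p * cosh t) * t - r * p * sinh t"

lemma active_fraction_bounds: "0 < active_fraction \<beta>" "active_fraction \<beta> < 1"
  using add_pos_pos[of "exp \<beta>" 2] by (auto simp: active_fraction_def)

lemma cumulant_eq: "cumulant \<beta> t = ln (1 + active_fraction \<beta> * (cosh t - 1))"
proof -
  have "(1 + 1 / E * c) / (1 + 2 * (1 / E)) = 1 + 2 / (E + 2) * (c / 2 - 1)" if "0 < E" for E c :: real
  proof -
    have "1 + 1 / E * c = (E + c) / E" "1 + 2 * (1 / E) = (E + 2) / E"
      using that by (simp_all add: field_simps)
    moreover have "(E + c) / (E + 2) = 1 + 2 / (E + 2) * (c / 2 - 1)"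
      using that by (simp add: field_simps)
    ultimately show ?thesis using that by simp
  qed
  from this[of "exp \<beta>" "exp t + exp (- t)"]
  have "(1 + exp (- \<beta>) * (exp t + exp (- t))) / (1 + 2 * exp (- \<beta>)) = 1 + active_fraction \<beta> * (cosh t - 1)"
    by (simp add: active_fraction_def cosh_field_def exp_minus inverse_eq_divide)
  then show ?thesis by (simp add: cumulant_def)
qed

lemma mix_cosh_bounds:
  assumes "0 \<le> p" "p \<le> 1"
  shows "1 \<le> 1 + p * (cosh t - 1)" "1 + p * (cosh t - 1) \<le> cosh (t::real)"
proof -
  have "1 \<le> cosh t" by (rule cosh_real_ge_1)
  with assms show "1 \<le> 1 + p * (cosh t - 1)" by simp
  have "p * (cosh t - 1) \<le> 1 * (cosh t - 1)"
    using assms \<open>1 \<le> cosh t\<close> by (intro mult_right_mono) auto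
  then show "1 + p * (cosh t - 1) \<le> cosh t" by simp
qed

lemma free_energy_even: "free_energy \<beta> K (- x) = free_energy \<beta> K x"
  by (simp add: free_energy_def cumulant_eq)

lemma free_energy_zero: "free_energy \<beta> K 0 = 0"
  by (simp add: free_energy_def cumulant_eq)

lemma free_energy_deriv:
  fixes \<beta> K x :: real
  defines "p \<equiv> active_fraction \<beta>" and "r \<equiv> 2 * \<beta> * K"
  shows "(free_energy \<beta> K has_real_derivative slope_numerator p r (r * x) / (1 + p * (cosh (r * x) - 1))) (at x)"
proof -
  have D: "0 < 1 + p * (cosh (r * x) - 1)"
    using mix_cosh_bounds(1)[of p "r * x"] active_fraction_bounds[of \<beta>] unfolding p_def by linarith
  have "((\<lambda>x. \<beta> * K * x\<^sup>2 - ln (1 + p * (cosh (r * x) - 1))) has_real_derivative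
      slope_numerator p r (r * x) / (1 + p * (cosh (r * x) - 1))) (at x)"
    using D by (auto intro!: derivative_eq_intros simp: slope_numerator_def r_def) (simp add: field_simps)
  moreover have "free_energy \<beta> K = (\<lambda>x. \<beta> * K * x\<^sup>2 - ln (1 + p * (cosh (r * x) - 1)))"
    by (simp add: fun_eq_iff free_energy_def cumulant_eq p_def r_def)
  ultimately show ?thesis by simp
qed

lemma nonneg_of_deriv_nonneg:
  fixes f :: "real \<Rightarrow> real"
  assumes "\<And>t. (f has_real_derivative f' t) (at t)" "\<And>t. 0 \<le> t \<Longrightarrow> 0 \<le> f' t" "0 \<le> f 0" "0 \<le> t"
  shows "0 \<le> f t"
proof -
  have "f 0 \<le> f t"
    by (rule DERIV_nonneg_imp_nondecreasing[OF \<open>0 \<le> t\<close>]) (use assms(1,2) in blast)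
  then show ?thesis using assms(3) by linarith
qed

lemma sinh_ge:
  assumes "0 \<le> t"
  shows "t \<le> sinh (t::real)"
proof -
  have "0 \<le> sinh t - t"
    by (rule nonneg_of_deriv_nonneg[where f="\<lambda>t. sinh t - t" and f'="\<lambda>t. cosh t - 1"])
       (use assms in \<open>auto intro!: derivative_eq_intros simp: cosh_real_ge_1\<close>)
  then show ?thesis by simp
qed

lemma sinh_le_mult_cosh:
  assumes "0 \<le> t"
  shows "sinh t \<le> t * cosh (t::real)"
proof -
  have "0 \<le> t * cosh t - sinh t"
    by (rule nonneg_of_deriv_nonneg[where f="\<lambda>t. t * cosh t - sinh t" and f'="\<lambda>t. t * sinh t"])
       (use assms in \<open>auto intro!: derivative_eq_intros\<close>)
  then show ?thesis by simp
qed

context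
  fixes r :: real
begin

text \<open>
  The part of the power series of \<open>t cosh t - r sinh t\<close> of degree at least five, that is
  the sum of \<open>(2 j + 1 - r) / (2 j + 1)! t\<^sup>2\<^sup>j\<^sup>+\<^sup>1\<close> over \<open>j \<ge> 2\<close>. For \<open>r < 5\<close> all of its coefficients are positive.
  The two bounds derived from this are proved by differentiating until only hyperbolic functions remain,
  which avoids manipulating the series.
\<close>
definition quintic_tail :: "real \<Rightarrow> real" where
  "quintic_tail t = t * cosh t - r * sinh t - (1 - r) * t - (3 - r) / 6 * t ^ 3"

definition quintic_tail_d1 :: "real \<Rightarrow> real" where
  "quintic_tail_d1 t = cosh t + t * sinh t - r * cosh t - (1 - r) - (3 - r) / 2 * t\<^sup>2"

definition quintic_tail_d2 :: "real \<Rightarrow> real" where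
  "quintic_tail_d2 t = (2 - r) * sinh t + t * cosh t - (3 - r) * t"

definition quintic_tail_d3 :: "real \<Rightarrow> real" where
  "quintic_tail_d3 t = (3 - r) * cosh t + t * sinh t - (3 - r)"

lemma quintic_tail_derivs [derivative_intros]:
  "(quintic_tail has_real_derivative quintic_tail_d1 t) (at t)"
  "(quintic_tail_d1 has_real_derivative quintic_tail_d2 t) (at t)"
  "(quintic_tail_d2 has_real_derivative quintic_tail_d3 t) (at t)"
  "(quintic_tail_d3 has_real_derivative (4 - r) * sinh t + t * cosh t) (at t)"
proof -
  show "(quintic_tail has_real_derivative quintic_tail_d1 t) (at t)"
    unfolding quintic_tail_def[abs_def] quintic_tail_d1_def
    by (rule derivative_eq_intros refl | simp)+
  show "(quintic_tail_d1 has_real_derivative quintic_tail_d2 t) (at t)"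
    unfolding quintic_tail_d1_def[abs_def] quintic_tail_d2_def
    by (rule derivative_eq_intros refl | simp)+ (simp add: algebra_simps)
  show "(quintic_tail_d2 has_real_derivative quintic_tail_d3 t) (at t)"
    unfolding quintic_tail_d2_def[abs_def] quintic_tail_d3_def
    by (rule derivative_eq_intros refl | simp)+ (simp add: algebra_simps)
  show "(quintic_tail_d3 has_real_derivative (4 - r) * sinh t + t * cosh t) (at t)"
    unfolding quintic_tail_d3_def[abs_def]
    by (rule derivative_eq_intros refl | simp)+ (simp add: algebra_simps)
qed

lemma quintic_tail_at_0:
  "quintic_tail 0 = 0" "quintic_tail_d1 0 = 0" "quintic_tail_d2 0 = 0" "quintic_tail_d3 0 = 0"
  by (simp_all add: quintic_tail_def quintic_tail_d1_def quintic_tail_d2_def quintic_tail_d3_def)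

lemma slope_numerator_eq:
  "slope_numerator p r t = (1 - r * p) * t + p * (3 - r) / 6 * t ^ 3 + p * quintic_tail t"
  by (simp add: slope_numerator_def quintic_tail_def algebra_simps)

lemma quintic_tail_fourth_deriv_ge:
  assumes "r \<le> 5" "0 \<le> t"
  shows "(5 - r) * t \<le> (4 - r) * sinh t + t * cosh t"
proof -
  have "(5 - r) * t \<le> (5 - r) * sinh t" using assms sinh_ge by (intro mult_left_mono) auto
  then show ?thesis using sinh_le_mult_cosh[OF assms(2)] by (simp add: algebra_simps)
qed

lemma quintic_tail_ge:
  assumes r: "r \<le> 5" and t: "0 \<le> t"
  shows "(5 - r) / 120 * t ^ 5 \<le> quintic_tail t"
proof -
  have 3: "0 \<le> quintic_tail_d3 t - (5 - r) / 2 * t\<^sup>2" if "0 \<le> t" for t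
    by (rule nonneg_of_deriv_nonneg[where f="\<lambda>t. quintic_tail_d3 t - (5 - r) / 2 * t\<^sup>2"
          and f'="\<lambda>t. (4 - r) * sinh t + t * cosh t - (5 - r) * t"])
       (use quintic_tail_fourth_deriv_ge[OF r] quintic_tail_at_0 that in \<open>auto intro!: derivative_eq_intros simp: field_simps\<close>)
  have 2: "0 \<le> quintic_tail_d2 t - (5 - r) / 6 * t ^ 3" if "0 \<le> t" for t
    by (rule nonneg_of_deriv_nonneg[where f="\<lambda>t. quintic_tail_d2 t - (5 - r) / 6 * t ^ 3"
          and f'="\<lambda>t. quintic_tail_d3 t - (5 - r) / 2 * t\<^sup>2"])
       (use 3 quintic_tail_at_0 that in \<open>auto intro!: derivative_eq_intros simp: field_simps\<close>)
  have 1: "0 \<le> quintic_tail_d1 t - (5 - r) / 24 * t ^ 4" if "0 \<le> t" for t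
    by (rule nonneg_of_deriv_nonneg[where f="\<lambda>t. quintic_tail_d1 t - (5 - r) / 24 * t ^ 4"
          and f'="\<lambda>t. quintic_tail_d2 t - (5 - r) / 6 * t ^ 3"])
       (use 2 quintic_tail_at_0 that in \<open>auto intro!: derivative_eq_intros simp: field_simps\<close>)
  have "0 \<le> quintic_tail t - (5 - r) / 120 * t ^ 5"
    by (rule nonneg_of_deriv_nonneg[where f="\<lambda>t. quintic_tail t - (5 - r) / 120 * t ^ 5"
          and f'="\<lambda>t. quintic_tail_d1 t - (5 - r) / 24 * t ^ 4"])
       (use 1 quintic_tail_at_0 t in \<open>auto intro!: derivative_eq_intros simp: field_simps\<close>)
  then show ?thesis by simp
qed

text \<open>
  A function whose power series has nonnegative coefficients and starts in degree at least three stays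
  nondecreasing after division by \<open>t\<^sup>3\<close>; this is the differential form of that statement for the tail.
\<close>
lemma quintic_tail_homogeneity_ge:
  assumes r: "r \<le> 5" and t: "0 \<le> t"
  shows "3 * quintic_tail t \<le> t * quintic_tail_d1 t"
proof -
  have 3: "0 \<le> t * quintic_tail_d3 t - quintic_tail_d2 t" if "0 \<le> t" for t
  proof (rule nonneg_of_deriv_nonneg[where f="\<lambda>t. t * quintic_tail_d3 t - quintic_tail_d2 t"
        and f'="\<lambda>t. t * ((4 - r) * sinh t + t * cosh t)"])
    show "0 \<le> t * ((4 - r) * sinh t + t * cosh t)" if "0 \<le> t" for t
      using quintic_tail_fourth_deriv_ge[OF r that] r that
      by (intro mult_nonneg_nonneg) (auto intro: order_trans[rotated])
  qed (use quintic_tail_at_0 that in \<open>auto intro!: derivative_eq_intros\<close>)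
  have 2: "0 \<le> t * quintic_tail_d2 t - 2 * quintic_tail_d1 t" if "0 \<le> t" for t
    by (rule nonneg_of_deriv_nonneg[where f="\<lambda>t. t * quintic_tail_d2 t - 2 * quintic_tail_d1 t"
          and f'="\<lambda>t. t * quintic_tail_d3 t - quintic_tail_d2 t"])
       (use 3 quintic_tail_at_0 that in \<open>auto intro!: derivative_eq_intros\<close>)
  have "0 \<le> t * quintic_tail_d1 t - 3 * quintic_tail t"
    by (rule nonneg_of_deriv_nonneg[where f="\<lambda>t. t * quintic_tail_d1 t - 3 * quintic_tail t"
          and f'="\<lambda>t. t * quintic_tail_d2 t - 2 * quintic_tail_d1 t"])
       (use 2 quintic_tail_at_0 t in \<open>auto intro!: derivative_eq_intros\<close>)
  then show ?thesis by simp
qed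

text \<open>
  As a power series in \<open>t\<close>, the numerator has a negative first coefficient, a cubic coefficient of
  either sign, and positive coefficients from degree five on: one sign change, hence, as in Descartes' rule,
  exactly one positive zero. Formally, after division by \<open>t\<^sup>3\<close> the linear part is strictly increasing,
  the cubic one is constant, and the tail is nondecreasing.
\<close>
lemma slope_numerator_sign_change:
  assumes p: "0 < p" and rp: "1 < r * p" and r: "r < 5"
  obtains t0 where "0 < t0" "\<And>t. 0 < t \<Longrightarrow> t < t0 \<Longrightarrow> slope_numerator p r t < 0" "\<And>t. t0 < t \<Longrightarrow> 0 < slope_numerator p r t"
proof -
  define q where "q t = slope_numerator p r t / t ^ 3" for t
  define q' where "q' t = 2 * (r * p - 1) / t ^ 3 + p * (t * quintic_tail_d1 t - 3 * quintic_tail t) / t ^ 4" for t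
  have q_eq: "q t = (1 - r * p) / t\<^sup>2 + p * (3 - r) / 6 + p * (quintic_tail t / t ^ 3)" if "0 < t" for t
    using that by (simp add: q_def slope_numerator_eq field_simps power2_eq_square power3_eq_cube)
  have dq: "(q has_real_derivative q' t) (at t)" if "0 < t" for t
  proof -
    have "((\<lambda>t. (1 - r * p) / t\<^sup>2 + p * (3 - r) / 6 + p * (quintic_tail t / t ^ 3)) has_real_derivative q' t) (at t)"
    proof -
      have "((\<lambda>t. (1 - r * p) / t\<^sup>2) has_real_derivative 2 * (r * p - 1) / t ^ 3) (at t)"
        using that by (auto intro!: derivative_eq_intros simp: field_simps eval_nat_numeral)
      note D1 = this
      have "((\<lambda>t. quintic_tail t / t ^ 3) has_real_derivative
          (t * quintic_tail_d1 t - 3 * quintic_tail t) / t ^ 4) (at t)"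
        using that by (auto intro!: derivative_eq_intros simp: field_simps eval_nat_numeral)
      from DERIV_add[OF DERIV_add[OF D1 DERIV_const] DERIV_cmult[OF this]]
      show ?thesis unfolding q'_def by simp
    qed
    then show ?thesis
      by (rule has_field_derivative_transform_within_open[where S="{0<..}"]) (use that q_eq in auto)
  qed
  have q'_pos: "0 < q' t" if "0 < t" for t
    unfolding q'_def using that p rp r quintic_tail_homogeneity_ge[of t]
    by (intro add_pos_nonneg divide_pos_pos divide_nonneg_pos mult_nonneg_nonneg) auto
  have q_mono: "q s < q t" if "0 < s" "s < t" for s t
    using that by (intro DERIV_pos_imp_increasing[OF \<open>s < t\<close>]) (meson dq q'_pos less_le_trans)
  have cont: "continuous_on {s..t} q" if "0 < s" for s t
    by (intro continuous_at_imp_continuous_on ballI)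
       (meson that dq DERIV_isCont atLeastAtMost_iff less_le_trans)
  have "(slope_numerator p r has_real_derivative 1 - r * p) (at 0)"
    unfolding slope_numerator_def[abs_def] by (auto intro!: derivative_eq_intros)
  then obtain d where d: "0 < d" "\<And>h. 0 < h \<Longrightarrow> h < d \<Longrightarrow> slope_numerator p r h < 0"
    using DERIV_neg_dec_right[of "slope_numerator p r" "1 - r * p" 0] rp by (auto simp: slope_numerator_def)
  define s where "s = d / 2"
  have s: "0 < s" "q s < 0" using d by (auto simp: s_def q_def divide_neg_pos)
  have "filterlim (\<lambda>t. (1 - r * p) + p * (3 - r) / 6 * t\<^sup>2 + p * ((5 - r) / 120) * t ^ 4) at_top at_top"
  proof -
    define a b c where "a = 1 - r * p" and "b = p * (3 - r) / 6" and "c = p * ((5 - r) / 120)"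
    have "0 < c" using p r by (simp add: c_def)
    then have "filterlim (\<lambda>t. a + b * t\<^sup>2 + c * t ^ 4) at_top at_top" by real_asymp
    then show ?thesis by (simp only: a_def b_def c_def)
  qed
  then have "\<forall>\<^sub>F t in at_top. 0 < (1 - r * p) + p * (3 - r) / 6 * t\<^sup>2 + p * ((5 - r) / 120) * t ^ 4"
    unfolding filterlim_at_top_dense by blast
  with eventually_gt_at_top[of s] have "\<forall>\<^sub>F t in at_top. s < t \<and> 0 < q t"
  proof eventually_elim
    case (elim t)
    then have t: "0 < t" using s by linarith
    have "0 < t * ((1 - r * p) + p * (3 - r) / 6 * t\<^sup>2 + p * ((5 - r) / 120) * t ^ 4)"
      using elim t by (intro mult_pos_pos)
    also have "\<dots> = (1 - r * p) * t + p * (3 - r) / 6 * t ^ 3 + p * ((5 - r) / 120 * t ^ 5)"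
      by (simp add: algebra_simps eval_nat_numeral)
    also have "\<dots> \<le> slope_numerator p r t"
      unfolding slope_numerator_eq using p r t quintic_tail_ge[of t] by (intro add_left_mono mult_left_mono) auto
    finally show ?case using elim t by (simp add: q_def)
  qed
  then obtain u where u: "s < u" "0 < q u" using eventually_happens' trivial_limit_at_top_linorder by blast
  obtain t0 where t0: "s \<le> t0" "q t0 = 0"
    using IVT'[of q s 0 u] s u cont[of s u] by force
  show thesis
  proof (rule that)
    show "0 < t0" using s t0 by linarith
    show "slope_numerator p r t < 0" if "0 < t" "t < t0" for t
      using q_mono[OF that] t0 that by (simp add: q_def divide_less_0_iff)
    show "0 < slope_numerator p r t" if "t0 < t" for t
      using q_mono[OF _ that] t0 that s by (simp add: q_def zero_less_divide_iff)
  qed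
qed

end

lemma free_energy_double_well:
  assumes "0 < \<beta>" "0 < K" "1 < 2 * \<beta> * K * active_fraction \<beta>" "2 * \<beta> * K < 5"
  shows "double_well (free_energy \<beta> K) (magnetization \<beta> K)"
proof -
  define p r where "p = active_fraction \<beta>" and "r = 2 * \<beta> * K"
  have r: "0 < r" using assms by (simp add: r_def)
  obtain t0 where t0: "0 < t0" "\<And>t. 0 < t \<Longrightarrow> t < t0 \<Longrightarrow> slope_numerator p r t < 0" "\<And>t. t0 < t \<Longrightarrow> 0 < slope_numerator p r t"
    using slope_numerator_sign_change[of p r] assms active_fraction_bounds[of \<beta>] by (auto simp: p_def r_def)
  have D: "0 < 1 + p * (cosh (r * x) - 1)" for x
    using mix_cosh_bounds(1)[of p "r * x"] active_fraction_bounds[of \<beta>] unfolding p_def by linarith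
  have "double_well (free_energy \<beta> K) (t0 / r)"
  proof (rule double_well_deriv)
    show "(free_energy \<beta> K has_real_derivative slope_numerator p r (r * x) / (1 + p * (cosh (r * x) - 1))) (at x)" for x
      unfolding p_def r_def by (rule free_energy_deriv)
    show "slope_numerator p r (r * x) / (1 + p * (cosh (r * x) - 1)) < 0" if "0 < x" "x < t0 / r" for x
      using t0(2)[of "r * x"] that r by (intro divide_neg_pos D) (auto simp: field_simps)
    show "0 < slope_numerator p r (r * x) / (1 + p * (cosh (r * x) - 1))" if "t0 / r < x" for x
      using t0(3)[of "r * x"] that r by (intro divide_pos_pos D) (auto simp: field_simps)
  qed (use t0 r in \<open>auto simp: free_energy_even\<close>)
  then show ?thesis using double_well_minimizer unfolding magnetization_def by simp
qed

text \<open>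
  For \<open>\<bar>t\<bar> \<le> 12\<close> the slope is bounded below by a quintic monomial minus a linear term of order \<open>c\<close>:
  the cubic part of the numerator, which may be negative, is absorbed in the linear term since \<open>t\<close> is
  bounded. For larger \<open>t\<close> the cumulant is at most \<open>\<bar>t\<bar>\<close>, which the quadratic term of the functional dominates.
\<close>
lemma free_energy_lower_bound:
  fixes \<beta> K c x :: real
  defines "p \<equiv> active_fraction \<beta>" and "r \<equiv> 2 * \<beta> * K"
  assumes p: "1 / 4 \<le> p" and r: "2 \<le> r" "r \<le> 4"
    and c: "\<bar>1 - r * p\<bar> \<le> c" "\<bar>3 - r\<bar> \<le> c"
  shows "min (x ^ 6 / (90 * cosh 12) - 50 * c * x\<^sup>2) (x\<^sup>2 / 6) \<le> free_energy \<beta> K x"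
proof -
  have p1: "0 < p" "p \<le> 1" using active_fraction_bounds[of \<beta>] by (auto simp: p_def)
  have c0: "0 \<le> c" using c by linarith
  define D where "D t = 1 + p * (cosh t - 1)" for t
  have D1: "1 \<le> D t" "D t \<le> cosh t" for t
    unfolding D_def using mix_cosh_bounds[of p t] p1 by auto
  have M: "0 < cosh (12::real)" by (rule cosh_real_pos)
  have main: "min (x ^ 6 / (90 * cosh 12) - 50 * c * x\<^sup>2) (x\<^sup>2 / 6) \<le> free_energy \<beta> K x" if x: "0 \<le> x" for x
  proof (cases "r * x \<le> 12")
    case True
    \<comment> \<open>With \<open>r \<ge> 2\<close>, \<open>t\<^sup>5 / 480 \<ge> z\<^sup>5 / 15\<close>; with \<open>r \<le> 4\<close>, \<open>25 c t \<le> 100 c z\<close>. The hyperbolic cosine is at most its value at \<open>12\<close>.\<close>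
    have slope: "z ^ 5 / (15 * cosh 12) - 100 * c * z \<le> slope_numerator p r (r * z) / D (r * z)" if z: "0 \<le> z" "z \<le> x" for z
    proof -
      define t where "t = r * z"
      have "r * z \<le> r * x" using z r by (intro mult_left_mono) auto
      then have t: "0 \<le> t" "t \<le> 12" using z r True unfolding t_def by (simp, linarith)
      have "t ^ 5 / 480 - 25 * c * t \<le> slope_numerator p r t"
      proof -
        have "- c * t \<le> (1 - r * p) * t" using c t by (intro mult_right_mono) auto
        moreover have "- (24 * c) * t \<le> p * (3 - r) / 6 * t ^ 3"
        proof -
          have "p * \<bar>3 - r\<bar> * (t\<^sup>2 / 6) \<le> 1 * c * (12\<^sup>2 / 6)"
            using p1 c t c0 by (intro mult_mono power_mono divide_right_mono) auto
          then have "\<bar>p * (3 - r) / 6 * t\<^sup>2\<bar> \<le> 24 * c" using p1 by (simp add: abs_mult mult_ac)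
          then have "- (24 * c) * t \<le> (p * (3 - r) / 6 * t\<^sup>2) * t" using t by (intro mult_right_mono) auto
          then show ?thesis by (simp add: eval_nat_numeral mult_ac)
        qed
        moreover have "t ^ 5 / 480 \<le> p * quintic_tail r t"
        proof -
          have "1 / 4 * (1 / 120 * t ^ 5) \<le> p * ((5 - r) / 120 * t ^ 5)"
            using p r t by (intro mult_mono divide_right_mono) auto
          also have "\<dots> \<le> p * quintic_tail r t"
            using quintic_tail_ge[of r t] p1 r t by (intro mult_left_mono) auto
          finally show ?thesis by simp
        qed
        ultimately show ?thesis unfolding slope_numerator_eq by linarith
      qed
      then have "(t ^ 5 / 480 - 25 * c * t) / D t \<le> slope_numerator p r t / D t"
        using D1(1)[of t] by (intro divide_right_mono) auto
      moreover have "t ^ 5 / (480 * cosh 12) - 25 * c * t \<le> (t ^ 5 / 480 - 25 * c * t) / D t"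
      proof -
        have "D t \<le> cosh 12" using D1(2)[of t] t by (auto intro: order_trans cosh_real_nonneg_le_iff[THEN iffD2])
        then have "(t ^ 5 / 480) / cosh 12 \<le> (t ^ 5 / 480) / D t"
          using D1(1)[of t] t by (intro divide_left_mono mult_pos_pos) auto
        moreover have "25 * c * t / D t \<le> 25 * c * t / 1"
          using D1(1)[of t] t c0 by (intro divide_left_mono) auto
        ultimately show ?thesis by (simp add: diff_divide_distrib)
      qed
      moreover have "z ^ 5 / (15 * cosh 12) \<le> t ^ 5 / (480 * cosh 12)"
      proof -
        have "(2 * z) ^ 5 \<le> t ^ 5" unfolding t_def using r z by (intro power_mono mult_right_mono) auto
        then have "32 * z ^ 5 \<le> t ^ 5" by (simp add: power_mult_distrib)
        then show ?thesis using M by (simp add: field_simps)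
      qed
      moreover have "25 * c * t \<le> 100 * c * z"
      proof -
        have "c * t \<le> c * (4 * z)" unfolding t_def using r z c0 by (intro mult_left_mono mult_right_mono) auto
        then show ?thesis by simp
      qed
      ultimately show ?thesis unfolding t_def by linarith
    qed
    have "(\<lambda>z. free_energy \<beta> K z - (z ^ 6 / (90 * cosh 12) - 50 * c * z\<^sup>2)) 0
        \<le> (\<lambda>z. free_energy \<beta> K z - (z ^ 6 / (90 * cosh 12) - 50 * c * z\<^sup>2)) x"
    proof (rule DERIV_nonneg_imp_nondecreasing[OF x], goal_cases)
      case (1 z)
      have "((\<lambda>z. free_energy \<beta> K z - (z ^ 6 / (90 * cosh 12) - 50 * c * z\<^sup>2)) has_real_derivative
          slope_numerator p r (r * z) / D (r * z) - (z ^ 5 / (15 * cosh 12) - 100 * c * z)) (at z)"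
        using M by (auto intro!: derivative_eq_intros free_energy_deriv simp: p_def r_def D_def field_simps)
      then show ?case using slope[of z] 1 by force
    qed
    then have "x ^ 6 / (90 * cosh 12) - 50 * c * x\<^sup>2 \<le> free_energy \<beta> K x"
      by (simp add: free_energy_zero)
    then show ?thesis by (rule min.coboundedI1)
  next
    case False
    define t where "t = r * x"
    have t: "12 \<le> t" using False by (simp add: t_def)
    have "D t \<le> exp t" using D1(2)[of t] cosh_plus_sinh[of t] sinh_ge[of t] t by linarith
    then have "ln (D t) \<le> t" using D1(1)[of t] ln_le_cancel_iff[of "D t" "exp t"] by simp
    moreover have "t \<le> r * x\<^sup>2 / 2 - x\<^sup>2 / 6"
    proof -
      have "12 * x \<le> t * x" using t x by (intro mult_right_mono) auto
      then have "12 * (r * x) \<le> r * (r * x\<^sup>2)" using mult_left_mono[of "12 * x" "t * x" r] r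
        by (simp add: t_def power2_eq_square mult_ac)
      also have "r * (r * x\<^sup>2) \<le> r * (6 * x\<^sup>2 - 2 * x\<^sup>2 / r)"
      proof -
        have "r * x\<^sup>2 \<le> 4 * x\<^sup>2" using r by (intro mult_right_mono) auto
        moreover have "2 * x\<^sup>2 / r \<le> 2 * x\<^sup>2 / 2" using r by (intro divide_left_mono) auto
        ultimately have "r * x\<^sup>2 \<le> 6 * x\<^sup>2 - 2 * x\<^sup>2 / r" using zero_le_power2[of x] by linarith
        then show ?thesis using r by (intro mult_left_mono) auto
      qed
      also have "\<dots> = 12 * (r * x\<^sup>2 / 2 - x\<^sup>2 / 6)"
        using r by (simp add: field_simps)
      finally show ?thesis unfolding t_def by simp
    qed
    moreover have "free_energy \<beta> K x = r * x\<^sup>2 / 2 - ln (D t)"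
      by (simp add: free_energy_def cumulant_eq D_def p_def r_def t_def)
    ultimately have "x\<^sup>2 / 6 \<le> free_energy \<beta> K x" by linarith
    then show ?thesis by (rule min.coboundedI2)
  qed
  show ?thesis
    using main[of x] main[of "- x"] by (cases "0 \<le> x") (auto simp: free_energy_even)
qed

section \<open>Sixth-order expansion at the tricritical point\<close>

text \<open>
  Chosen such that \<open>ln (1 + p (cosh t - 1)) = p t\<^sup>2 / 2 - p (3 p - 1) / 24 t\<^sup>4 - sextic_remainder p t * t\<^sup>6\<close>:
  the Taylor polynomial of the cumulant up to degree four, with all else in the remainder.
\<close>
definition sextic_remainder :: "real \<Rightarrow> real \<Rightarrow> real" where
  "sextic_remainder p t = (p * t\<^sup>2 / 2 - p * (3 * p - 1) / 24 * t ^ 4 - ln (1 + p * (cosh t - 1))) / t ^ 6"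

text \<open>
  The remainder is a polynomial in \<open>p\<close>, \<open>t\<close> and the normalized Taylor remainders \<open>\<phi>\<close> of \<open>cosh\<close> and \<open>\<psi>\<close> of
  \<open>ln\<close>. Both converge at \<open>0\<close>, so joint convergence in \<open>p\<close> and \<open>t\<close> is a matter of continuity, which
  replaces an error estimate uniform in \<open>p\<close>. The limit is \<open>- 1 / 2160 + 1 / 432 - 1 / 648\<close>.
\<close>
lemma sextic_remainder_tendsto:
  assumes p: "(p \<longlongrightarrow> 1 / 3) F" and t: "(t \<longlongrightarrow> 0) F" "\<forall>\<^sub>F n in F. t n \<noteq> 0"
  shows "((\<lambda>n. sextic_remainder (p n) (t n)) \<longlongrightarrow> 1 / 3240) F"
proof -
  define \<phi> where "\<phi> t = (cosh t - 1 - t\<^sup>2 / 2 - t ^ 4 / 24) / t ^ 6" for t :: real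
  define \<psi> where "\<psi> v = (ln (1 + v) - v + v\<^sup>2 / 2) / v ^ 3" for v :: real
  define w where "w t = 1 / 2 + t\<^sup>2 / 24 + t ^ 4 * \<phi> t" for t
  define R where "R p t = - p * \<phi> t + p\<^sup>2 / 2 * (1 / 24 + t\<^sup>2 * (1 / 576 + \<phi> t) + t ^ 4 * \<phi> t / 12 + t ^ 6 * (\<phi> t)\<^sup>2)
      - p ^ 3 * (w t) ^ 3 * \<psi> (p * (cosh t - 1))" for p t
  have R_eq: "sextic_remainder p t = R p t" if "t \<noteq> 0" "p \<noteq> 0" for p t
  proof -
    define v where "v = p * (cosh t - 1)"
    have v: "v = p * t\<^sup>2 * w t"
      using that by (simp add: v_def w_def \<phi>_def field_simps eval_nat_numeral)
    have "v \<noteq> 0" using that cosh_real_one_iff by (auto simp: v_def)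
    then have ln: "ln (1 + v) = v - v\<^sup>2 / 2 + v ^ 3 * \<psi> v" by (simp add: \<psi>_def)
    have "p * t\<^sup>2 / 2 - p * (3 * p - 1) / 24 * t ^ 4 - ln (1 + v) = t ^ 6 * R p t"
      unfolding ln R_def v_def[symmetric] unfolding v unfolding w_def
      by (simp add: algebra_simps power2_eq_square power3_eq_cube eval_nat_numeral) (simp add: field_simps)
    then show ?thesis using that by (simp add: sextic_remainder_def v_def)
  qed
  have "(\<phi> \<longlongrightarrow> 1 / 720) (at 0)" unfolding \<phi>_def by real_asymp
  moreover have t0: "filterlim t (at 0) F" using t by (simp add: filterlim_at)
  ultimately have \<phi>: "((\<lambda>n. \<phi> (t n)) \<longlongrightarrow> 1 / 720) F" by (rule filterlim_compose)
  have "(\<psi> \<longlongrightarrow> 1 / 3) (at 0)" unfolding \<psi>_def by real_asymp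
  moreover have "filterlim (\<lambda>n. p n * (cosh (t n) - 1)) (at 0) F"
  proof -
    have "((\<lambda>n. p n * (cosh (t n) - 1)) \<longlongrightarrow> 1 / 3 * (cosh 0 - 1)) F"
      by (intro tendsto_intros p t)
    moreover have "\<forall>\<^sub>F n in F. 0 < p n" using order_tendstoD(1)[OF p, of 0] by simp
    then have "\<forall>\<^sub>F n in F. p n * (cosh (t n) - 1) \<noteq> 0"
      using t(2) by eventually_elim (auto simp: cosh_real_one_iff)
    ultimately show ?thesis by (simp add: filterlim_at)
  qed
  ultimately have \<psi>: "((\<lambda>n. \<psi> (p n * (cosh (t n) - 1))) \<longlongrightarrow> 1 / 3) F" by (rule filterlim_compose)
  have w: "((\<lambda>n. w (t n)) \<longlongrightarrow> 1 / 2 + 0\<^sup>2 / 24 + 0 ^ 4 * (1 / 720)) F"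
    unfolding w_def by (intro tendsto_intros t \<phi>) simp
  have "((\<lambda>n. R (p n) (t n)) \<longlongrightarrow>
      - (1 / 3) * (1 / 720) + (1 / 3)\<^sup>2 / 2 * (1 / 24 + 0\<^sup>2 * (1 / 576 + 1 / 720) + 0 ^ 4 * (1 / 720) / 12 + 0 ^ 6 * (1 / 720)\<^sup>2)
      - (1 / 3) ^ 3 * (1 / 2 + 0\<^sup>2 / 24 + 0 ^ 4 * (1 / 720)) ^ 3 * (1 / 3)) F"
    unfolding R_def by (intro tendsto_intros p t \<phi> \<psi> w) simp_all
  then have "((\<lambda>n. R (p n) (t n)) \<longlongrightarrow> 1 / 3240) F" by (simp add: power2_eq_square eval_nat_numeral)
  moreover have "\<forall>\<^sub>F n in F. R (p n) (t n) = sextic_remainder (p n) (t n)"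
    using t(2) order_tendstoD(1)[OF p, of 0, simplified] by eventually_elim (simp add: R_eq)
  ultimately show ?thesis by (rule Lim_transform_eventually)
qed

lemma free_energy_expansion:
  fixes \<beta> K x :: real
  defines "p \<equiv> active_fraction \<beta>" and "r \<equiv> 2 * \<beta> * K"
  assumes "r \<noteq> 0" "x \<noteq> 0"
  shows "free_energy \<beta> K x = r / 2 * (1 - r * p) * x\<^sup>2 + r ^ 4 * (p * (3 * p - 1) / 24) * x ^ 4
    + r ^ 6 * sextic_remainder p (r * x) * x ^ 6"
proof -
  have "sextic_remainder p (r * x) * (r * x) ^ 6
      = p * (r * x)\<^sup>2 / 2 - p * (3 * p - 1) / 24 * (r * x) ^ 4 - ln (1 + p * (cosh (r * x) - 1))"
    using assms by (simp add: sextic_remainder_def)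
  moreover have "free_energy \<beta> K x = r / 2 * x\<^sup>2 - ln (1 + p * (cosh (r * x) - 1))"
    by (simp add: free_energy_def cumulant_eq p_def r_def)
  ultimately have "free_energy \<beta> K x = r / 2 * x\<^sup>2 - p * (r * x)\<^sup>2 / 2
      + p * (3 * p - 1) / 24 * (r * x) ^ 4 + sextic_remainder p (r * x) * (r * x) ^ 6" by linarith
  then show ?thesis unfolding power_mult_distrib by (simp add: field_simps power2_eq_square)
qed

section \<open>The Ginzburg--Landau polynomials\<close>

lemma sextic_dominates_quadratic:
  fixes a M :: real
  assumes "0 < a"
  obtains C where "\<And>y. M * y\<^sup>2 - C \<le> a * y ^ 6"
proof
  \<comment> \<open>With \<open>N\<close> the positive part of \<open>M\<close>, the constant \<open>C = N (1 + N / a)\<close> works: beyond \<open>y\<^sup>2 = 1 + N / a\<close> the sextic term wins.\<close>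
  fix y :: real
  define N where "N = max M 0"
  define z where "z = y\<^sup>2"
  have z: "0 \<le> z" "y ^ 6 = z ^ 3" by (simp_all add: z_def flip: power_mult)
  have N: "0 \<le> N" "M \<le> N" by (auto simp: N_def)
  have "N * z - N * (1 + N / a) \<le> a * z ^ 3"
  proof (cases "z \<le> 1 + N / a")
    case True
    then have "N * z \<le> N * (1 + N / a)" using N by (intro mult_left_mono) auto
    moreover have "0 \<le> a * z ^ 3" using assms z by simp
    ultimately show ?thesis by linarith
  next
    case False
    moreover have "0 \<le> N / a" using N assms by simp
    ultimately have z1: "1 \<le> z" "N / a \<le> z" by linarith+
    then have "N / a \<le> z * z" using mult_mono[of 1 z "N / a" z] N z assms by simp
    then have "N \<le> a * (z * z)" using assms by (simp add: field_simps)
    then have "N * z \<le> a * (z * z) * z" using z by (intro mult_right_mono)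
    moreover have "0 \<le> N * (1 + N / a)" using N assms by simp
    ultimately show ?thesis by (simp add: power3_eq_cube mult_ac)
  qed
  moreover have "M * z \<le> N * z" using N z by (intro mult_right_mono) auto
  ultimately have "M * z - N * (1 + N / a) \<le> a * z ^ 3" by linarith
  then show "M * y\<^sup>2 - max M 0 * (1 + max M 0 / a) \<le> a * y ^ 6"
    unfolding z(2) unfolding N_def z_def .
qed

lemma beta_c_pos: "0 < beta_c"
  by (simp add: beta_c_def)

lemma K_curve_beta_c: "K_curve beta_c = 3 / (2 * beta_c)"
  by (simp add: K_curve_def beta_c_def)

lemma gl_poly_tilde_coercive:
  obtains C where "\<And>y. y\<^sup>2 - C \<le> gl_poly_tilde y"
  using sextic_dominates_quadratic[of c6 1] by (auto simp: gl_poly_tilde_def c6_def)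

lemma gl_poly_coercive:
  obtains C where "\<And>y. y\<^sup>2 - C \<le> gl_poly b k y"
proof -
  define a where "a = beta_c * (deriv K_curve beta_c * b - k)"
  obtain C where C: "\<And>y. (1 - a) * y\<^sup>2 - C \<le> c6 * y ^ 6"
    using sextic_dominates_quadratic[of c6 "1 - a"] by (auto simp: c6_def)
  show thesis
  proof (rule that)
    show "y\<^sup>2 - C \<le> gl_poly b k y" for y
      using C[of y] unfolding gl_poly_def a_def[symmetric] by (simp add: algebra_simps)
  qed
qed

lemma gl_poly_borel [measurable]: "gl_poly b k \<in> borel_measurable borel"
  unfolding gl_poly_def[abs_def] by simp

lemma gl_poly_tilde_borel [measurable]: "gl_poly_tilde \<in> borel_measurable borel"
  unfolding gl_poly_tilde_def[abs_def] by simp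

lemma y_bar_pos: "0 < y_bar"
  unfolding y_bar_def by (rule gl_poly_tilde_coercive) (rule gibbs_mean_abs_pos[OF gl_poly_tilde_borel])

lemma z_bar_pos: "0 < z_bar b k"
  unfolding z_bar_def by (rule gl_poly_coercive[of b k]) (rule gibbs_mean_abs_pos[OF gl_poly_borel])

lemma gl_poly_double_well:
  assumes "deriv K_curve beta_c * b - k < 0"
  shows "double_well (gl_poly b k) (x_bar b k)"
proof -
  define a where "a = beta_c * (deriv K_curve beta_c * b - k)"
  define m where "m = root 4 (- a / (3 * c6))"
  have a: "a < 0" using assms beta_c_pos by (simp add: a_def mult_pos_neg)
  have m: "0 < m" "m ^ 4 = - a / (3 * c6)" using a by (auto simp: m_def c6_def)
  have "double_well (gl_poly b k) m"
  proof (rule double_well_deriv)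
    show "(gl_poly b k has_real_derivative 6 * c6 * x * (x ^ 4 - m ^ 4)) (at x)" for x
      unfolding gl_poly_def[abs_def] a_def[symmetric] m(2)
      by (auto intro!: derivative_eq_intros simp: c6_def algebra_simps eval_nat_numeral)
    show "6 * c6 * x * (x ^ 4 - m ^ 4) < 0" if "0 < x" "x < m" for x
      using that power_strict_mono[of x m 4] by (intro mult_pos_neg) (auto simp: c6_def)
    show "0 < 6 * c6 * x * (x ^ 4 - m ^ 4)" if "m < x" for x
      using that m power_strict_mono[of m x 4] by (intro mult_pos_pos) (auto simp: c6_def)
  qed (use m in \<open>auto simp: gl_poly_def\<close>)
  then show ?thesis using double_well_minimizer unfolding x_bar_def by simp
qed

lemma difference_quotient_tendsto:
  fixes f :: "real \<Rightarrow> real"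
  assumes f: "(f has_real_derivative D) (at a)" and e: "filterlim e (at 0) F"
  shows "((\<lambda>n. (f (a + b * e n) - f a) / e n) \<longlongrightarrow> D * b) F"
proof -
  have "((\<lambda>h. f (a + b * h)) has_real_derivative D * b) (at 0)"
    using f by (intro DERIV_chain2[where f=f]) (auto intro!: derivative_eq_intros)
  then have "((\<lambda>h. (f (a + b * h) - f a) / h) \<longlongrightarrow> D * b) (at 0)"
    by (simp add: DERIV_def)
  then show ?thesis by (rule filterlim_compose[OF _ e])
qed

section \<open>Paths into the tricritical point\<close>

text \<open>
  A path that approaches the tricritical point from inside the phase-coexistence region, as the
  condition \<open>slope\<close> states to first order in \<open>\<epsilon> = n\<^sup>-\<^sup>\<alpha>\<close>.
\<close>
locale tricritical_path =
  fixes b k \<alpha> :: real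
  assumes \<alpha>_pos: "0 < \<alpha>" and slope: "deriv K_curve beta_c * b - k < 0"
begin

definition \<epsilon> :: "nat \<Rightarrow> real" where "\<epsilon> n = real n powr - \<alpha>"
definition \<beta> :: "nat \<Rightarrow> real" where "\<beta> n = beta_seq b \<alpha> n"
definition K :: "nat \<Rightarrow> real" where "K n = K_seq k \<alpha> n"
definition p :: "nat \<Rightarrow> real" where "p n = active_fraction (\<beta> n)"
definition r :: "nat \<Rightarrow> real" where "r n = 2 * \<beta> n * K n"

lemma \<beta>_eq: "\<beta> n = beta_c + b * \<epsilon> n" and K_eq: "K n = K_curve beta_c + k * \<epsilon> n"
  by (simp_all add: \<beta>_def K_def beta_seq_def K_seq_def \<epsilon>_def powr_minus divide_inverse)

lemma \<epsilon>_tendsto: "\<epsilon> \<longlonglongrightarrow> 0"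
  unfolding \<epsilon>_def by (intro tendsto_neg_powr filterlim_real_sequentially) (use \<alpha>_pos in simp)

lemma \<epsilon>_pos: "\<forall>\<^sub>F n in sequentially. 0 < \<epsilon> n"
  using eventually_gt_at_top[of 0] by eventually_elim (simp add: \<epsilon>_def)

lemma \<epsilon>_at_0: "filterlim \<epsilon> (at 0) sequentially"
  using \<epsilon>_tendsto \<epsilon>_pos by (auto simp: filterlim_at elim: eventually_mono)

lemma \<beta>_tendsto: "\<beta> \<longlonglongrightarrow> beta_c"
  unfolding \<beta>_eq using tendsto_add[OF tendsto_const tendsto_mult[OF tendsto_const \<epsilon>_tendsto]] by force

lemma K_tendsto: "K \<longlonglongrightarrow> K_curve beta_c"
  unfolding K_eq using tendsto_add[OF tendsto_const tendsto_mult[OF tendsto_const \<epsilon>_tendsto]] by force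

lemma r_tendsto: "r \<longlonglongrightarrow> 3"
proof -
  have "r \<longlonglongrightarrow> 2 * beta_c * K_curve beta_c"
    unfolding r_def by (intro tendsto_intros \<beta>_tendsto K_tendsto)
  then show ?thesis using beta_c_pos by (simp add: K_curve_beta_c)
qed

lemma p_tendsto: "p \<longlonglongrightarrow> 1 / 3"
proof -
  have "p \<longlonglongrightarrow> 2 / (exp beta_c + 2)"
    unfolding p_def active_fraction_def
    by (intro tendsto_intros \<beta>_tendsto) (simp add: beta_c_def)
  then show ?thesis by (simp add: beta_c_def)
qed

lemma eventually_pos:
  "\<forall>\<^sub>F n in sequentially. 0 < \<beta> n" "\<forall>\<^sub>F n in sequentially. 0 < K n"
  using order_tendstoD(1)[OF \<beta>_tendsto] order_tendstoD(1)[OF K_tendsto] beta_c_pos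
  by (auto simp: K_curve_beta_c)

text \<open>
  Since \<open>1 - r p = (K_curve \<beta> - K) / K_curve \<beta>\<close>, the quadratic coefficient measures how far \<open>K\<close> lies from the
  curve, and to first order in \<open>\<epsilon>\<close> this distance is
  \<open>\<epsilon> (K_curve' (\<beta>\<^sub>c) b - k)\<close>.
\<close>
lemma quadratic_coeff_tendsto:
  "(\<lambda>n. r n / 2 * ((1 - r n * p n) / \<epsilon> n)) \<longlonglongrightarrow> beta_c * (deriv K_curve beta_c * b - k)"
proof -
  have "(K_curve has_real_derivative deriv K_curve beta_c) (at beta_c)"
  proof -
    have "\<exists>D. (K_curve has_real_derivative D) (at beta_c)"
      unfolding K_curve_def[abs_def] using beta_c_pos
      by (intro exI) (rule derivative_eq_intros refl | simp)+
    then show ?thesis using DERIV_imp_deriv by blast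
  qed
  from difference_quotient_tendsto[OF this \<epsilon>_at_0, of b]
  have num: "(\<lambda>n. (K_curve (\<beta> n) - K_curve beta_c) / \<epsilon> n - k) \<longlonglongrightarrow> deriv K_curve beta_c * b - k"
    unfolding \<beta>_eq by (intro tendsto_intros)
  have den: "(\<lambda>n. K_curve (\<beta> n)) \<longlonglongrightarrow> K_curve beta_c"
    unfolding K_curve_def using beta_c_pos by (intro tendsto_intros \<beta>_tendsto) auto
  have "(\<lambda>n. r n / 2 * (((K_curve (\<beta> n) - K_curve beta_c) / \<epsilon> n - k) / K_curve (\<beta> n)))
      \<longlonglongrightarrow> 3 / 2 * ((deriv K_curve beta_c * b - k) / K_curve beta_c)"
    using beta_c_pos
    by (intro tendsto_mult[OF tendsto_divide[OF r_tendsto tendsto_const] tendsto_divide[OF num den]])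
       (auto simp: K_curve_beta_c)
  then have lim: "(\<lambda>n. r n / 2 * (((K_curve (\<beta> n) - K_curve beta_c) / \<epsilon> n - k) / K_curve (\<beta> n)))
      \<longlonglongrightarrow> beta_c * (deriv K_curve beta_c * b - k)"
    using beta_c_pos by (simp add: K_curve_beta_c)
  have "\<forall>\<^sub>F n in sequentially. r n / 2 * (((K_curve (\<beta> n) - K_curve beta_c) / \<epsilon> n - k) / K_curve (\<beta> n))
      = r n / 2 * ((1 - r n * p n) / \<epsilon> n)"
    using eventually_pos(1) \<epsilon>_pos
  proof eventually_elim
    case (elim n)
    have pos: "0 < K_curve (\<beta> n)" unfolding K_curve_def using elim by (intro divide_pos_pos add_pos_pos) auto
    have "(K_curve (\<beta> n) - K_curve beta_c) / \<epsilon> n - k = (K_curve (\<beta> n) - K n) / \<epsilon> n"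
      using elim by (simp add: K_eq field_simps)
    moreover have "r n * p n = K n / K_curve (\<beta> n)"
      by (simp add: r_def p_def active_fraction_def K_curve_def)
    then have "(K_curve (\<beta> n) - K n) / K_curve (\<beta> n) = 1 - r n * p n"
      using pos by (simp add: diff_divide_distrib)
    ultimately have "((K_curve (\<beta> n) - K_curve beta_c) / \<epsilon> n - k) / K_curve (\<beta> n) = (1 - r n * p n) / \<epsilon> n"
      by (metis divide_divide_eq_left mult.commute)
    then show ?case by simp
  qed
  with lim show ?thesis by (rule Lim_transform_eventually)
qed

lemma quadratic_coeff_neg: "\<forall>\<^sub>F n in sequentially. 1 - r n * p n < 0"
proof -
  have "beta_c * (deriv K_curve beta_c * b - k) < 0" using slope beta_c_pos by (simp add: mult_pos_neg)
  from order_tendstoD(2)[OF quadratic_coeff_tendsto this] \<epsilon>_pos order_tendstoD(1)[OF r_tendsto, of 0, simplified]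
  show ?thesis by eventually_elim (auto simp: mult_less_0_iff divide_less_0_iff)
qed

lemma eventually_double_well:
  "\<forall>\<^sub>F n in sequentially. double_well (free_energy (\<beta> n) (K n)) (magnetization (\<beta> n) (K n))"
  using eventually_pos quadratic_coeff_neg order_tendstoD(2)[OF r_tendsto, of 5, simplified]
  by eventually_elim (rule free_energy_double_well; simp add: r_def p_def)

lemma quartic_coeff_convergent: "\<exists>c. (\<lambda>n. (3 * p n - 1) / \<epsilon> n) \<longlonglongrightarrow> c"
proof -
  have D: "(active_fraction has_real_derivative - 2 * exp beta_c / (exp beta_c + 2)\<^sup>2) (at beta_c)"
    unfolding active_fraction_def[abs_def]
    by (auto intro!: derivative_eq_intros simp: power2_eq_square add_pos_pos less_imp_neq[symmetric])
  have "active_fraction beta_c = 1 / 3" by (simp add: active_fraction_def beta_c_def)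
  with tendsto_mult[OF tendsto_const difference_quotient_tendsto[OF D \<epsilon>_at_0, of b], of 3]
  show ?thesis unfolding p_def \<beta>_eq by (auto simp: right_diff_distrib)
qed

lemma r_diff_convergent: "\<exists>c. (\<lambda>n. (3 - r n) / \<epsilon> n) \<longlonglongrightarrow> c"
proof -
  have "(\<lambda>n. - 2 * (b * K n + beta_c * k)) \<longlonglongrightarrow> - 2 * (b * K_curve beta_c + beta_c * k)"
    by (intro tendsto_intros K_tendsto)
  moreover have "\<forall>\<^sub>F n in sequentially. - 2 * (b * K n + beta_c * k) = (3 - r n) / \<epsilon> n"
    using \<epsilon>_pos
  proof eventually_elim
    case (elim n)
    have "2 * beta_c * K_curve beta_c = 3" using beta_c_pos by (simp add: K_curve_beta_c)
    then have "3 - r n = - 2 * (b * K n + beta_c * k) * \<epsilon> n"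
      unfolding r_def by (simp add: \<beta>_eq K_eq algebra_simps)
    then show ?case using elim by simp
  qed
  ultimately have "(\<lambda>n. (3 - r n) / \<epsilon> n) \<longlonglongrightarrow> - 2 * (b * K_curve beta_c + beta_c * k)"
    by (rule Lim_transform_eventually)
  then show ?thesis by blast
qed

lemma coefficients_bounded:
  "\<exists>L. \<forall>\<^sub>F n in sequentially. \<bar>1 - r n * p n\<bar> \<le> L * \<epsilon> n \<and> \<bar>3 - r n\<bar> \<le> L * \<epsilon> n"
proof -
  define a where "a = beta_c * (deriv K_curve beta_c * b - k)"
  obtain c where c: "(\<lambda>n. (3 - r n) / \<epsilon> n) \<longlonglongrightarrow> c" using r_diff_convergent by blast
  have "\<forall>\<^sub>F n in sequentially. \<bar>r n / 2 * ((1 - r n * p n) / \<epsilon> n)\<bar> < \<bar>a\<bar> + 1"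
    "\<forall>\<^sub>F n in sequentially. \<bar>(3 - r n) / \<epsilon> n\<bar> < \<bar>c\<bar> + 1"
    using order_tendstoD(2)[OF tendsto_rabs[OF quadratic_coeff_tendsto]] order_tendstoD(2)[OF tendsto_rabs[OF c]]
    by (auto simp: a_def)
  then have "\<forall>\<^sub>F n in sequentially. \<bar>1 - r n * p n\<bar> \<le> (\<bar>a\<bar> + \<bar>c\<bar> + 1) * \<epsilon> n \<and> \<bar>3 - r n\<bar> \<le> (\<bar>a\<bar> + \<bar>c\<bar> + 1) * \<epsilon> n"
    using \<epsilon>_pos order_tendstoD(1)[OF r_tendsto, of 2, simplified]
  proof eventually_elim
    case (elim n)
    have "\<bar>(1 - r n * p n) / \<epsilon> n\<bar> \<le> r n / 2 * \<bar>(1 - r n * p n) / \<epsilon> n\<bar>"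
      using mult_right_mono[of 1 "r n / 2" "\<bar>(1 - r n * p n) / \<epsilon> n\<bar>"] elim by simp
    also have "\<dots> = \<bar>r n / 2 * ((1 - r n * p n) / \<epsilon> n)\<bar>" using elim by (simp add: abs_mult)
    finally have "\<bar>(1 - r n * p n) / \<epsilon> n\<bar> \<le> \<bar>a\<bar> + \<bar>c\<bar> + 1" "\<bar>(3 - r n) / \<epsilon> n\<bar> \<le> \<bar>a\<bar> + \<bar>c\<bar> + 1"
      using elim by linarith+
    then show ?case using elim by (simp add: field_simps)
  qed
  then show ?thesis by blast
qed

context
  fixes s :: "nat \<Rightarrow> real" and \<kappa> :: real
  assumes s_pos: "\<forall>\<^sub>F n in sequentially. 0 < s n"
    and s_tendsto: "s \<longlonglongrightarrow> 0"
    and ratio: "(\<lambda>n. \<epsilon> n / s n ^ 4) \<longlonglongrightarrow> \<kappa>"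
begin

text \<open>
  The exponent \<open>6\<close> matches the order of the first Taylor coefficient that survives at the tricritical point.
\<close>
definition zoomed :: "nat \<Rightarrow> real \<Rightarrow> real" where
  "zoomed n y = free_energy (\<beta> n) (K n) (s n * y) / s n ^ 6"

lemma zoomed_borel: "zoomed n \<in> borel_measurable borel"
proof -
  have "isCont (free_energy (\<beta> n) (K n)) x" for x
    by (rule DERIV_isCont[OF free_energy_deriv])
  then have cont: "continuous_on UNIV (free_energy (\<beta> n) (K n))"
    by (simp add: continuous_at_imp_continuous_on)
  have "continuous_on UNIV (\<lambda>y. free_energy (\<beta> n) (K n) (s n * y))"
    by (rule continuous_on_compose2[OF cont]) (auto intro!: continuous_intros)
  then have "continuous_on UNIV (\<lambda>y. free_energy (\<beta> n) (K n) (s n * y) * inverse (s n ^ 6))"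
    by (rule continuous_on_mult_right)
  then show ?thesis
    unfolding zoomed_def[abs_def] divide_inverse by (rule borel_measurable_continuous_onI)
qed

lemma zoomed_tendsto:
  "(\<lambda>n. zoomed n y) \<longlonglongrightarrow> \<kappa> * (beta_c * (deriv K_curve beta_c * b - k)) * y\<^sup>2 + c6 * y ^ 6"
proof (cases "y = 0")
  case True
  then show ?thesis by (simp add: zoomed_def free_energy_zero)
next
  case y: False
  obtain c where c: "(\<lambda>n. (3 * p n - 1) / \<epsilon> n) \<longlonglongrightarrow> c" using quartic_coeff_convergent by blast
  have rpos: "\<forall>\<^sub>F n in sequentially. 0 < r n" using order_tendstoD(1)[OF r_tendsto, of 0] by simp
  have t: "(\<lambda>n. r n * (s n * y)) \<longlonglongrightarrow> 0"
    using tendsto_mult[OF r_tendsto tendsto_mult[OF s_tendsto tendsto_const[of y]]] by simp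
  have t0: "\<forall>\<^sub>F n in sequentially. r n * (s n * y) \<noteq> 0"
    using rpos s_pos by eventually_elim (use y in auto)
  note R = sextic_remainder_tendsto[OF p_tendsto t t0]
  have "(\<lambda>n. (\<epsilon> n / s n ^ 4) * (r n / 2 * ((1 - r n * p n) / \<epsilon> n)) * y\<^sup>2
        + r n ^ 4 * p n / 24 * ((3 * p n - 1) / \<epsilon> n) * (\<epsilon> n / s n ^ 4) * (s n)\<^sup>2 * y ^ 4
        + r n ^ 6 * sextic_remainder (p n) (r n * (s n * y)) * y ^ 6)
      \<longlonglongrightarrow> \<kappa> * (beta_c * (deriv K_curve beta_c * b - k)) * y\<^sup>2
        + 3 ^ 4 * (1 / 3) / 24 * c * \<kappa> * 0\<^sup>2 * y ^ 4 + 3 ^ 6 * (1 / 3240) * y ^ 6"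
    by (intro tendsto_add tendsto_mult tendsto_power tendsto_divide tendsto_const
        ratio quadratic_coeff_tendsto r_tendsto p_tendsto c s_tendsto R) simp_all
  then have lim: "(\<lambda>n. (\<epsilon> n / s n ^ 4) * (r n / 2 * ((1 - r n * p n) / \<epsilon> n)) * y\<^sup>2
        + r n ^ 4 * p n / 24 * ((3 * p n - 1) / \<epsilon> n) * (\<epsilon> n / s n ^ 4) * (s n)\<^sup>2 * y ^ 4
        + r n ^ 6 * sextic_remainder (p n) (r n * (s n * y)) * y ^ 6)
      \<longlonglongrightarrow> \<kappa> * (beta_c * (deriv K_curve beta_c * b - k)) * y\<^sup>2 + c6 * y ^ 6"
    by (simp add: c6_def)
  have "\<forall>\<^sub>F n in sequentially. (\<epsilon> n / s n ^ 4) * (r n / 2 * ((1 - r n * p n) / \<epsilon> n)) * y\<^sup>2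
        + r n ^ 4 * p n / 24 * ((3 * p n - 1) / \<epsilon> n) * (\<epsilon> n / s n ^ 4) * (s n)\<^sup>2 * y ^ 4
        + r n ^ 6 * sextic_remainder (p n) (r n * (s n * y)) * y ^ 6 = zoomed n y"
    using rpos s_pos \<epsilon>_pos
  proof eventually_elim
    case (elim n)
    have "free_energy (\<beta> n) (K n) (s n * y) = r n / 2 * (1 - r n * p n) * (s n * y)\<^sup>2
        + r n ^ 4 * (p n * (3 * p n - 1) / 24) * (s n * y) ^ 4
        + r n ^ 6 * sextic_remainder (p n) (r n * (s n * y)) * (s n * y) ^ 6"
      by (rule free_energy_expansion[of "\<beta> n" "K n" "s n * y", folded r_def p_def]) (use elim y in auto)
    moreover have "r n / 2 * (1 - r n * p n) * (s n * y)\<^sup>2 / s n ^ 6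
        = (\<epsilon> n / s n ^ 4) * (r n / 2 * ((1 - r n * p n) / \<epsilon> n)) * y\<^sup>2"
    proof -
      have "(s n * y)\<^sup>2 / s n ^ 6 = y\<^sup>2 / s n ^ 4" using elim by (simp add: eval_nat_numeral)
      then have "r n / 2 * (1 - r n * p n) * (s n * y)\<^sup>2 / s n ^ 6 = r n / 2 * (1 - r n * p n) * (y\<^sup>2 / s n ^ 4)"
        by (metis times_divide_eq_right)
      then show ?thesis using elim by simp
    qed
    moreover have "r n ^ 4 * (p n * (3 * p n - 1) / 24) * (s n * y) ^ 4 / s n ^ 6
        = r n ^ 4 * p n / 24 * ((3 * p n - 1) / \<epsilon> n) * (\<epsilon> n / s n ^ 4) * (s n)\<^sup>2 * y ^ 4"
    proof -
      have "(s n * y) ^ 4 / s n ^ 6 = (s n)\<^sup>2 * y ^ 4 / s n ^ 4" using elim by (simp add: eval_nat_numeral)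
      then have "r n ^ 4 * (p n * (3 * p n - 1) / 24) * (s n * y) ^ 4 / s n ^ 6
          = r n ^ 4 * (p n * (3 * p n - 1) / 24) * ((s n)\<^sup>2 * y ^ 4 / s n ^ 4)"
        by (metis times_divide_eq_right)
      then show ?thesis using elim by simp
    qed
    moreover have "r n ^ 6 * sextic_remainder (p n) (r n * (s n * y)) * (s n * y) ^ 6 / s n ^ 6
        = r n ^ 6 * sextic_remainder (p n) (r n * (s n * y)) * y ^ 6"
      using elim by (simp add: power_mult_distrib)
    ultimately show ?case unfolding zoomed_def by (simp only: add_divide_distrib)
  qed
  with lim show ?thesis by (rule Lim_transform_eventually)
qed

lemma zoomed_coercive:
  obtains C where "\<forall>\<^sub>F n in sequentially. \<forall>y. y\<^sup>2 - C \<le> zoomed n y"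
proof -
  obtain L where L: "\<forall>\<^sub>F n in sequentially. \<bar>1 - r n * p n\<bar> \<le> L * \<epsilon> n \<and> \<bar>3 - r n\<bar> \<le> L * \<epsilon> n"
    using coefficients_bounded by blast
  \<comment> \<open>\<open>B\<close> bounds the coefficients of size \<open>L \<epsilon>\<close> after division by \<open>s\<^sup>4\<close>, eventually in \<open>n\<close>.\<close>
  define B where "B = \<bar>L\<bar> * (\<bar>\<kappa>\<bar> + 1)"
  obtain C where C: "\<And>y. (1 + 50 * B) * y\<^sup>2 - C \<le> 1 / (90 * cosh 12) * y ^ 6"
    using sextic_dominates_quadratic[of "1 / (90 * cosh 12)" "1 + 50 * B"] by (auto simp: cosh_real_pos)
  have "C \<ge> 0" using C[of 0] by simp
  have "(\<lambda>n. s n ^ 4) \<longlonglongrightarrow> 0 ^ 4" by (intro tendsto_intros s_tendsto)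
  then have small: "\<forall>\<^sub>F n in sequentially. s n ^ 4 < 1 / 6" by (rule order_tendstoD(2)) simp
  have "\<forall>\<^sub>F n in sequentially. \<bar>\<epsilon> n / s n ^ 4\<bar> < \<bar>\<kappa>\<bar> + 1"
    by (rule order_tendstoD(2)[OF tendsto_rabs[OF ratio]]) simp
  then have "\<forall>\<^sub>F n in sequentially. \<forall>y. y\<^sup>2 - C \<le> zoomed n y"
    using L small s_pos \<epsilon>_pos order_tendstoD(1)[OF r_tendsto, of 2, simplified]
      order_tendstoD(2)[OF r_tendsto, of 4, simplified] order_tendstoD(1)[OF p_tendsto, of "1 / 4", simplified]
  proof eventually_elim
    case (elim n)
    show ?case
    proof
      fix y
      define G where "G = free_energy (\<beta> n) (K n) (s n * y)"
      have "min ((s n * y) ^ 6 / (90 * cosh 12) - 50 * (L * \<epsilon> n) * (s n * y)\<^sup>2) ((s n * y)\<^sup>2 / 6) \<le> G"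
        unfolding G_def by (rule free_energy_lower_bound) (use elim in \<open>auto simp: r_def p_def\<close>)
      then consider "(s n * y) ^ 6 / (90 * cosh 12) - 50 * (L * \<epsilon> n) * (s n * y)\<^sup>2 \<le> G"
        | "(s n * y)\<^sup>2 / 6 \<le> G" by linarith
      then show "y\<^sup>2 - C \<le> zoomed n y"
      proof cases
        case 1
        have "L * (\<epsilon> n / s n ^ 4) \<le> \<bar>L\<bar> * \<bar>\<epsilon> n / s n ^ 4\<bar>"
          by (metis abs_ge_self abs_mult)
        also have "\<dots> \<le> B" unfolding B_def using elim by (intro mult_left_mono) auto
        finally have "L * (\<epsilon> n / s n ^ 4) * y\<^sup>2 \<le> B * y\<^sup>2" by (intro mult_right_mono) auto
        then have "y\<^sup>2 - C \<le> y ^ 6 / (90 * cosh 12) - 50 * (L * (\<epsilon> n / s n ^ 4) * y\<^sup>2)"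
          using C[of y] by (simp add: algebra_simps)
        also have "\<dots> = ((s n * y) ^ 6 / (90 * cosh 12) - 50 * (L * \<epsilon> n) * (s n * y)\<^sup>2) / s n ^ 6"
        proof -
          have "(s n * y) ^ 6 / (90 * cosh 12) / s n ^ 6 = y ^ 6 / (90 * cosh 12)"
            using elim by (simp add: power_mult_distrib)
          moreover have "(s n * y)\<^sup>2 / s n ^ 6 = y\<^sup>2 / s n ^ 4" using elim by (simp add: eval_nat_numeral)
          then have "50 * (L * \<epsilon> n) * (s n * y)\<^sup>2 / s n ^ 6 = 50 * (L * \<epsilon> n) * (y\<^sup>2 / s n ^ 4)"
            by (metis times_divide_eq_right)
          then have "50 * (L * \<epsilon> n) * (s n * y)\<^sup>2 / s n ^ 6 = 50 * (L * (\<epsilon> n / s n ^ 4) * y\<^sup>2)"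
            by simp
          ultimately show ?thesis by (simp add: diff_divide_distrib)
        qed
        also have "\<dots> \<le> zoomed n y"
          unfolding zoomed_def G_def[symmetric] using 1 elim by (intro divide_right_mono) auto
        finally show ?thesis .
      next
        case 2
        have "y\<^sup>2 * (6 * s n ^ 4) \<le> y\<^sup>2 * 1" using elim by (intro mult_left_mono) auto
        then have "y\<^sup>2 \<le> (s n * y)\<^sup>2 / 6 / s n ^ 6"
          using elim by (simp add: field_simps eval_nat_numeral)
        also have "\<dots> \<le> zoomed n y"
          unfolding zoomed_def G_def[symmetric] using 2 elim by (intro divide_right_mono) auto
        finally show ?thesis using \<open>C \<ge> 0\<close> by linarith
      qed
    qed
  qed
  then show thesis by (rule that)
qed

lemma eventually_zoomed_double_well:
  "\<forall>\<^sub>F n in sequentially. double_well (zoomed n) (magnetization (\<beta> n) (K n) / s n)"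
  using eventually_double_well s_pos
proof eventually_elim
  case (elim n)
  show ?case using double_well_rescale[OF elim(1), of "1 / s n ^ 6" "s n"] elim(2)
    by (simp add: zoomed_def[abs_def])
qed

text \<open>
  The Gaussian noise has size of order \<open>n\<^sup>-\<^sup>1\<^sup>/\<^sup>2\<close> and vanishes relative to \<open>s\<close> by \<open>noise\<close>.
\<close>
lemma mean_abs_spin_tendsto:
  assumes noise: "filterlim (\<lambda>n. s n * sqrt (real n)) at_top sequentially"
    and gibbs: "(\<lambda>n. gibbs_mean_abs (\<lambda>y. real n * s n ^ 6 * zoomed n y)) \<longlonglongrightarrow> l"
  shows "(\<lambda>n. mean_abs_spin n (\<beta> n) (K n) / s n) \<longlonglongrightarrow> l"
proof -
  have "(\<lambda>n. 1 / sqrt (pi * (\<beta> n * K n)) * inverse (s n * sqrt (real n)))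
      \<longlonglongrightarrow> 1 / sqrt (pi * (beta_c * K_curve beta_c)) * 0"
    by (intro tendsto_intros \<beta>_tendsto K_tendsto tendsto_inverse_0_at_top noise)
       (use beta_c_pos in \<open>simp add: K_curve_beta_c\<close>)
  then have err: "(\<lambda>n. 1 / sqrt (pi * (\<beta> n * K n)) * inverse (s n * sqrt (real n))) \<longlonglongrightarrow> 0" by simp
  have "\<forall>\<^sub>F n in sequentially. norm (mean_abs_spin n (\<beta> n) (K n) / s n
      - gibbs_mean_abs (\<lambda>y. real n * s n ^ 6 * zoomed n y))
      \<le> 1 / sqrt (pi * (\<beta> n * K n)) * inverse (s n * sqrt (real n))"
    using eventually_pos s_pos eventually_gt_at_top[of 0]
  proof eventually_elim
    case (elim n)
    have "gibbs_mean_abs (\<lambda>x. real n * free_energy (\<beta> n) (K n) x)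
        = s n * gibbs_mean_abs (\<lambda>y. real n * s n ^ 6 * zoomed n y)"
      using gibbs_mean_abs_rescale[OF elim(3), of "\<lambda>x. real n * free_energy (\<beta> n) (K n) x"] elim
      by (simp add: zoomed_def)
    then have "\<bar>mean_abs_spin n (\<beta> n) (K n) - s n * gibbs_mean_abs (\<lambda>y. real n * s n ^ 6 * zoomed n y)\<bar>
        \<le> 1 / sqrt (pi * real n * \<beta> n * K n)"
      using mean_abs_spin_gibbs_bound[of n "\<beta> n" "K n"] elim by simp
    then have "\<bar>mean_abs_spin n (\<beta> n) (K n) - s n * gibbs_mean_abs (\<lambda>y. real n * s n ^ 6 * zoomed n y)\<bar> / s n
        \<le> 1 / sqrt (pi * real n * \<beta> n * K n) / s n"
      using elim by (intro divide_right_mono) auto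
    moreover have "1 / sqrt (pi * real n * \<beta> n * K n) / s n
        = 1 / sqrt (pi * (\<beta> n * K n)) * inverse (s n * sqrt (real n))"
      by (simp add: real_sqrt_mult divide_inverse mult_ac)
    moreover have "\<bar>X - s n * Y\<bar> / s n = \<bar>X / s n - Y\<bar>" for X Y
    proof -
      have "(X - s n * Y) / s n = X / s n - Y" using elim by (simp add: diff_divide_distrib)
      then show ?thesis using elim by (metis abs_divide abs_of_pos)
    qed
    ultimately show ?case by simp
  qed
  then have "(\<lambda>n. mean_abs_spin n (\<beta> n) (K n) / s n
      - gibbs_mean_abs (\<lambda>y. real n * s n ^ 6 * zoomed n y)) \<longlonglongrightarrow> 0"
    by (rule Lim_null_comparison[OF _ err])
  from tendsto_add[OF this gibbs] show ?thesis by simp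
qed

end

end

section \<open>Scaling regimes\<close>

lemma powr_rescale_power: "0 < real n \<Longrightarrow> (real n powr - \<gamma>) ^ j = real n powr - (real j * \<gamma>)"
  by (simp add: powr_power mult.commute)

lemma sim_of_rescaled_limit:
  assumes "(\<lambda>n. a n / real n powr - \<gamma>) \<longlonglongrightarrow> l" "l \<noteq> 0"
  shows "a \<sim> (\<lambda>n. l / real n powr \<gamma>)"
proof -
  have "(\<lambda>n. (a n / real n powr - \<gamma>) / l) \<longlonglongrightarrow> l / l"
    using assms by (intro tendsto_divide tendsto_const)
  then show ?thesis using assms(2) by (simp add: powr_minus divide_inverse mult_ac)
qed

lemma sim_sym:
  assumes "a \<sim> c"
  shows "c \<sim> a"
  using tendsto_inverse[OF assms] by simp

lemma sim_cong:
  assumes "a \<sim> c" "\<forall>\<^sub>F n in sequentially. c n = c' n"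
  shows "a \<sim> c'"
  using assms(1) by (rule Lim_transform_eventually) (use assms(2) in eventually_elim, simp)

context tricritical_path
begin

lemma \<epsilon>_ratio: "0 < real n \<Longrightarrow> \<epsilon> n / (real n powr - \<gamma>) ^ 4 = real n powr (4 * \<gamma> - \<alpha>)"
  by (simp add: \<epsilon>_def powr_rescale_power flip: powr_diff)

lemma \<epsilon>_ratio_critical:
  assumes "\<alpha> = 4 * \<gamma>"
  shows "(\<lambda>n. \<epsilon> n / (real n powr - \<gamma>) ^ 4) \<longlonglongrightarrow> 1"
  by (rule Lim_transform_eventually[OF tendsto_const])
     (use eventually_gt_at_top[of 0] in eventually_elim, simp only: \<epsilon>_ratio of_nat_0_less_iff, simp add: assms)

lemma \<epsilon>_ratio_subcritical:
  assumes "4 * \<gamma> < \<alpha>"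
  shows "(\<lambda>n. \<epsilon> n / (real n powr - \<gamma>) ^ 4) \<longlonglongrightarrow> 0"
proof (rule Lim_transform_eventually)
  have "(\<lambda>n. real n powr - (\<alpha> - 4 * \<gamma>)) \<longlonglongrightarrow> 0"
    by (intro tendsto_neg_powr filterlim_real_sequentially) (use assms in simp)
  then show "(\<lambda>n. real n powr (4 * \<gamma> - \<alpha>)) \<longlonglongrightarrow> 0" by simp
  show "\<forall>\<^sub>F n in sequentially. real n powr (4 * \<gamma> - \<alpha>) = \<epsilon> n / (real n powr - \<gamma>) ^ 4"
    using eventually_gt_at_top[of 0] by eventually_elim (simp add: \<epsilon>_ratio)
qed

lemma x_bar_pos: "0 < x_bar b k"
  using gl_poly_double_well[OF slope] by (simp add: double_well_def)

lemma scale_pos: "\<forall>\<^sub>F n in sequentially. 0 < real n powr - \<gamma>"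
  using eventually_gt_at_top[of 0] by eventually_elim simp

lemma scale_tendsto: "0 < \<gamma> \<Longrightarrow> (\<lambda>n. real n powr - \<gamma>) \<longlonglongrightarrow> 0"
  by (intro tendsto_neg_powr filterlim_real_sequentially) simp

lemma scale_noise:
  assumes "\<gamma> < 1 / 2"
  shows "filterlim (\<lambda>n. real n powr - \<gamma> * sqrt (real n)) at_top sequentially"
proof -
  have "filterlim (\<lambda>n. real n powr (1 / 2 - \<gamma>)) at_top sequentially"
    using assms by real_asymp
  moreover have "real n powr - \<gamma> * sqrt (real n) = real n powr (1 / 2 - \<gamma>)" for n
    using powr_add[of "real n" "- \<gamma>" "1 / 2"] by (simp add: powr_half_sqrt)
  ultimately show ?thesis by (simp only:)
qed

lemma magnetization_rescaled_tendsto: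
  "(\<lambda>n. magnetization (\<beta> n) (K n) / real n powr - (\<alpha> / 4)) \<longlonglongrightarrow> x_bar b k"
proof -
  have sc: "\<forall>\<^sub>F n in sequentially. 0 < real n powr - (\<alpha> / 4)" "(\<lambda>n. real n powr - (\<alpha> / 4)) \<longlonglongrightarrow> 0"
    "(\<lambda>n. \<epsilon> n / (real n powr - (\<alpha> / 4)) ^ 4) \<longlonglongrightarrow> 1"
    using \<alpha>_pos by (auto intro!: scale_pos scale_tendsto \<epsilon>_ratio_critical)
  show ?thesis
    using zoomed_tendsto[OF sc]
    by (intro double_well_tendsto[OF eventually_zoomed_double_well[OF sc] gl_poly_double_well[OF slope]])
       (simp add: gl_poly_def)
qed

lemma magnetization_sim: "(\<lambda>n. magnetization (\<beta> n) (K n)) \<sim> (\<lambda>n. x_bar b k / real n powr (\<alpha> / 4))"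
  by (rule sim_of_rescaled_limit[OF magnetization_rescaled_tendsto]) (use x_bar_pos in simp)

text \<open>
  At the scale of the magnetization the Boltzmann factor is \<open>exp (- n\<^sup>1\<^sup>-\<^sup>3\<^sup>\<alpha>\<^sup>/\<^sup>2 f\<^sub>n)\<close> with \<open>f\<^sub>n\<close> converging; the
  exponent \<open>1 - 3 \<alpha> / 2\<close> is positive precisely below the threshold \<open>2 / 3\<close>, and the fluctuations around
  the wells are then negligible.
\<close>
lemma mean_abs_spin_slow:
  assumes "\<alpha> < 2 / 3"
  shows "(\<lambda>n. mean_abs_spin n (\<beta> n) (K n) / real n powr - (\<alpha> / 4)) \<longlonglongrightarrow> x_bar b k"
proof -
  have sc: "\<forall>\<^sub>F n in sequentially. 0 < real n powr - (\<alpha> / 4)" "(\<lambda>n. real n powr - (\<alpha> / 4)) \<longlonglongrightarrow> 0"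
    "(\<lambda>n. \<epsilon> n / (real n powr - (\<alpha> / 4)) ^ 4) \<longlonglongrightarrow> 1"
    using \<alpha>_pos by (auto intro!: scale_pos scale_tendsto \<epsilon>_ratio_critical)
  obtain C where C: "\<forall>\<^sub>F n in sequentially. \<forall>y. y\<^sup>2 - C \<le> zoomed (\<lambda>n. real n powr - (\<alpha> / 4)) n y"
    using zoomed_coercive[OF sc] by blast
  have "filterlim (\<lambda>n. real n powr (1 - 3 / 2 * \<alpha>)) at_top sequentially"
    using assms by real_asymp
  then have L: "filterlim (\<lambda>n. real n * (real n powr - (\<alpha> / 4)) ^ 6) at_top sequentially"
  proof (rule filterlim_mono_eventually[OF _ order_refl order_refl])
    show "\<forall>\<^sub>F n in sequentially. real n powr (1 - 3 / 2 * \<alpha>) = real n * (real n powr - (\<alpha> / 4)) ^ 6"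
      using eventually_gt_at_top[of 0]
      by eventually_elim (simp add: powr_rescale_power powr_mult_base)
  qed
  have "isCont (gl_poly b k) (x_bar b k)" unfolding gl_poly_def[abs_def] by (intro continuous_intros)
  moreover have "(\<lambda>n. zoomed (\<lambda>n. real n powr - (\<alpha> / 4)) n y) \<longlonglongrightarrow> gl_poly b k y" for y
    using zoomed_tendsto[OF sc, of y] by (simp add: gl_poly_def)
  ultimately have "(\<lambda>n. gibbs_mean_abs (\<lambda>y. real n * (real n powr - (\<alpha> / 4)) ^ 6
      * zoomed (\<lambda>n. real n powr - (\<alpha> / 4)) n y)) \<longlonglongrightarrow> x_bar b k"
    by (rule gibbs_mean_abs_concentrates[OF eventually_zoomed_double_well[OF sc] gl_poly_double_well[OF slope] _
          zoomed_borel[OF sc] _ C L])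
  then show ?thesis
    by (rule mean_abs_spin_tendsto[OF sc scale_noise, rotated]) (use assms in simp)
qed

text \<open>
  At the scale \<open>n\<^sup>-\<^sup>1\<^sup>/\<^sup>6\<close> the sextic term of \<open>n G\<close> is of order one. The wells either disappear in the limit
  (\<open>\<kappa> = 0\<close>) or compete with the fluctuations on equal terms (\<open>\<kappa> = 1\<close>).
\<close>
lemma mean_abs_spin_fast:
  assumes ratio: "(\<lambda>n. \<epsilon> n / (real n powr - (1 / 6)) ^ 4) \<longlonglongrightarrow> \<kappa>"
    and g: "g = (\<lambda>y. \<kappa> * (beta_c * (deriv K_curve beta_c * b - k)) * y\<^sup>2 + c6 * y ^ 6)"
  shows "(\<lambda>n. mean_abs_spin n (\<beta> n) (K n) / real n powr - (1 / 6)) \<longlonglongrightarrow> gibbs_mean_abs g"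
proof -
  have sc: "\<forall>\<^sub>F n in sequentially. 0 < real n powr - (1 / 6)" "(\<lambda>n. real n powr - (1 / 6)) \<longlonglongrightarrow> 0"
    by (auto intro!: scale_pos scale_tendsto)
  let ?f = "zoomed (\<lambda>n. real n powr - (1 / 6))"
  obtain C where C: "\<forall>\<^sub>F n in sequentially. \<forall>y. y\<^sup>2 - C \<le> ?f n y"
    using zoomed_coercive[OF sc ratio] by blast
  have "(\<lambda>n. gibbs_mean_abs (?f n)) \<longlonglongrightarrow> gibbs_mean_abs g"
    by (rule gibbs_mean_abs_tendsto[OF zoomed_borel[OF sc ratio] _ _ C])
       (use zoomed_tendsto[OF sc ratio] in \<open>simp_all add: g\<close>)
  moreover have "\<forall>\<^sub>F n in sequentially. gibbs_mean_abs (?f n)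
      = gibbs_mean_abs (\<lambda>y. real n * (real n powr - (1 / 6)) ^ 6 * ?f n y)"
    using eventually_gt_at_top[of 0]
  proof eventually_elim
    case (elim n)
    then have "real n * (real n powr - (1 / 6)) ^ 6 = 1"
      by (subst powr_rescale_power) (simp_all add: powr_mult_base)
    then show ?case by (simp only: mult_1_left)
  qed
  ultimately have "(\<lambda>n. gibbs_mean_abs (\<lambda>y. real n * (real n powr - (1 / 6)) ^ 6 * ?f n y))
      \<longlonglongrightarrow> gibbs_mean_abs g"
    by (rule Lim_transform_eventually)
  then show ?thesis by (intro mean_abs_spin_tendsto[OF sc ratio] scale_noise) simp_all
qed

lemma magnetization_sim_abs_beta:
  assumes "\<bar>b\<bar> = 1"
  shows "(\<lambda>n. magnetization (\<beta> n) (K n)) \<sim> (\<lambda>n. x_bar b k * \<bar>beta_c - \<beta> n\<bar> powr (1 / 4))"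
proof (rule sim_cong[OF magnetization_sim])
  show "\<forall>\<^sub>F n in sequentially. x_bar b k / real n powr (\<alpha> / 4) = x_bar b k * \<bar>beta_c - \<beta> n\<bar> powr (1 / 4)"
    using \<epsilon>_pos
  proof eventually_elim
    case (elim n)
    then have "\<bar>beta_c - \<beta> n\<bar> = \<epsilon> n" using assms by (simp add: \<beta>_eq abs_mult)
    moreover have "\<epsilon> n powr (1 / 4) = inverse (real n powr (\<alpha> / 4))"
      by (simp add: \<epsilon>_def powr_powr flip: powr_minus)
    ultimately show ?case by (simp only: divide_inverse)
  qed
qed

lemma mean_abs_spin_dominates:
  assumes "2 / 3 < \<alpha>" "0 < l"
  shows "(\<lambda>n. l / real n powr (1 / 6)) \<ggreater> (\<lambda>n. magnetization (\<beta> n) (K n))"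
proof -
  have "filterlim (\<lambda>n. l / x_bar b k * real n powr (\<alpha> / 4 - 1 / 6)) at_top sequentially"
  proof -
    have "0 < l / x_bar b k" using assms x_bar_pos by simp
    moreover have "filterlim (\<lambda>n. real n powr (\<alpha> / 4 - 1 / 6)) at_top sequentially"
      using assms by real_asymp
    ultimately show ?thesis by (rule filterlim_tendsto_pos_mult_at_top[OF tendsto_const])
  qed
  then have "filterlim (\<lambda>n. (x_bar b k / real n powr (\<alpha> / 4)) / magnetization (\<beta> n) (K n)
      * (l / x_bar b k * real n powr (\<alpha> / 4 - 1 / 6))) at_top sequentially"
    by (rule filterlim_tendsto_pos_mult_at_top[OF sim_sym[OF magnetization_sim] zero_less_one])
  then show ?thesis
    by (rule filterlim_mono_eventually[OF _ order_refl order_refl])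
       (use eventually_gt_at_top[of 0] in eventually_elim,
        simp only: powr_diff, use x_bar_pos in simp)
qed

end

theorem theorem5p3:
  fixes b k :: real
  assumes "b \<in> {1, 0, -1}" and "k \<noteq> 0"
    and "deriv K_curve beta_c * b - k < 0"
  shows
    "(\<forall>\<alpha>>0.
        (\<lambda>n. magnetization (beta_seq b \<alpha> n) (K_seq k \<alpha> n))
          \<sim> (\<lambda>n. x_bar b k / real n powr (\<alpha> / 4))
      \<and> (b \<noteq> 0 \<longrightarrow>
          (\<lambda>n. magnetization (beta_seq b \<alpha> n) (K_seq k \<alpha> n))
            \<sim> (\<lambda>n. x_bar b k * \<bar>beta_c - beta_seq b \<alpha> n\<bar> powr (1 / 4))))
     \<and>
     (\<forall>\<alpha>. 0 < \<alpha> \<and> \<alpha> < 2 / 3 \<longrightarrow>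
        (\<lambda>n. mean_abs_spin n (beta_seq b \<alpha> n) (K_seq k \<alpha> n))
          \<sim> (\<lambda>n. x_bar b k / real n powr (\<alpha> / 4))
      \<and> (\<lambda>n. x_bar b k / real n powr (\<alpha> / 4))
          \<sim> (\<lambda>n. magnetization (beta_seq b \<alpha> n) (K_seq k \<alpha> n)))
     \<and>
     (\<forall>\<alpha>>2 / 3.
        (\<lambda>n. mean_abs_spin n (beta_seq b \<alpha> n) (K_seq k \<alpha> n))
          \<sim> (\<lambda>n. y_bar / real n powr (1 / 6))
      \<and> (\<lambda>n. y_bar / real n powr (1 / 6))
          \<ggreater> (\<lambda>n. magnetization (beta_seq b \<alpha> n) (K_seq k \<alpha> n)))
     \<and>
     (\<forall>\<alpha>. \<alpha> = 2 / 3 \<longrightarrow>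
        (\<lambda>n. mean_abs_spin n (beta_seq b \<alpha> n) (K_seq k \<alpha> n))
          \<sim> (\<lambda>n. z_bar b k / real n powr (1 / 6))
      \<and> (\<lambda>n. z_bar b k / real n powr (1 / 6))
          \<sim> (\<lambda>n. z_bar b k * magnetization (beta_seq b \<alpha> n) (K_seq k \<alpha> n) / x_bar b k))"
proof (intro conjI allI impI; (elim conjE)?)
  have path: "tricritical_path b k \<alpha>" if "0 < \<alpha>" for \<alpha>
    using assms(3) that by (simp add: tricritical_path_def)
  fix \<alpha> :: real
  {
    assume \<alpha>: "\<alpha> > 0"
    interpret tricritical_path b k \<alpha> by (rule path[OF \<alpha>])
    show "(\<lambda>n. magnetization (beta_seq b \<alpha> n) (K_seq k \<alpha> n)) \<sim> (\<lambda>n. x_bar b k / real n powr (\<alpha> / 4))"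
      using magnetization_sim unfolding \<beta>_def K_def .
    assume "b \<noteq> 0"
    then have "\<bar>b\<bar> = 1" using assms(1) by auto
    then show "(\<lambda>n. magnetization (beta_seq b \<alpha> n) (K_seq k \<alpha> n))
        \<sim> (\<lambda>n. x_bar b k * \<bar>beta_c - beta_seq b \<alpha> n\<bar> powr (1 / 4))"
      using magnetization_sim_abs_beta unfolding \<beta>_def K_def by blast
  next
    assume \<alpha>: "0 < \<alpha>" "\<alpha> < 2 / 3"
    interpret tricritical_path b k \<alpha> by (rule path[OF \<alpha>(1)])
    show "(\<lambda>n. mean_abs_spin n (beta_seq b \<alpha> n) (K_seq k \<alpha> n)) \<sim> (\<lambda>n. x_bar b k / real n powr (\<alpha> / 4))"
      using sim_of_rescaled_limit[OF mean_abs_spin_slow[OF \<alpha>(2)]] x_bar_pos unfolding \<beta>_def K_def by auto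
    show "(\<lambda>n. x_bar b k / real n powr (\<alpha> / 4)) \<sim> (\<lambda>n. magnetization (beta_seq b \<alpha> n) (K_seq k \<alpha> n))"
      using sim_sym[OF magnetization_sim] unfolding \<beta>_def K_def .
  next
    assume \<alpha>: "2 / 3 < \<alpha>"
    interpret tricritical_path b k \<alpha> by (rule path) (use \<alpha> in simp)
    have "(\<lambda>n. \<epsilon> n / (real n powr - (1 / 6)) ^ 4) \<longlonglongrightarrow> 0" by (rule \<epsilon>_ratio_subcritical) (use \<alpha> in simp)
    from mean_abs_spin_fast[OF this refl]
    have "(\<lambda>n. mean_abs_spin n (\<beta> n) (K n) / real n powr - (1 / 6)) \<longlonglongrightarrow> y_bar"
      by (simp add: y_bar_def gl_poly_tilde_def[abs_def])
    from sim_of_rescaled_limit[OF this] y_bar_pos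
    show "(\<lambda>n. mean_abs_spin n (beta_seq b \<alpha> n) (K_seq k \<alpha> n)) \<sim> (\<lambda>n. y_bar / real n powr (1 / 6))"
      unfolding \<beta>_def K_def by auto
    show "(\<lambda>n. y_bar / real n powr (1 / 6)) \<ggreater> (\<lambda>n. magnetization (beta_seq b \<alpha> n) (K_seq k \<alpha> n))"
      using mean_abs_spin_dominates[OF \<alpha> y_bar_pos] unfolding \<beta>_def K_def .
  next
    assume \<alpha>: "\<alpha> = 2 / 3"
    interpret tricritical_path b k \<alpha> by (rule path) (use \<alpha> in simp)
    have "(\<lambda>n. \<epsilon> n / (real n powr - (1 / 6)) ^ 4) \<longlonglongrightarrow> 1" by (rule \<epsilon>_ratio_critical) (use \<alpha> in simp)
    from mean_abs_spin_fast[OF this refl]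
    have "(\<lambda>n. mean_abs_spin n (\<beta> n) (K n) / real n powr - (1 / 6)) \<longlonglongrightarrow> z_bar b k"
      by (simp add: z_bar_def gl_poly_def[abs_def])
    from sim_of_rescaled_limit[OF this] z_bar_pos[of b k]
    show "(\<lambda>n. mean_abs_spin n (beta_seq b \<alpha> n) (K_seq k \<alpha> n)) \<sim> (\<lambda>n. z_bar b k / real n powr (1 / 6))"
      unfolding \<beta>_def K_def by auto
    have "\<alpha> / 4 = 1 / 6" using \<alpha> by simp
    moreover have "z_bar b k / A / (z_bar b k * m / x_bar b k) = x_bar b k / A / m" for A m
      using z_bar_pos[of b k] x_bar_pos by simp
    ultimately show "(\<lambda>n. z_bar b k / real n powr (1 / 6))
        \<sim> (\<lambda>n. z_bar b k * magnetization (beta_seq b \<alpha> n) (K_seq k \<alpha> n) / x_bar b k)"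
      using sim_sym[OF magnetization_sim] unfolding \<beta>_def K_def by (simp only:)
  }
qed

end
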